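(* Let $\mathrm{FG}_2$ denote the free group on two generators. (1) The Thompson group $V$ contains a subgroup isomorphic to $\mathrm{FG}_2$ with linear distortion. (2) The group $V$ also contains a subgroup isomorphic to $\mathrm{FG}_2\times\mathrm{FG}_2$ with linear distortion.
   Context: For a group $G$ with finite generating set $B$ and $g\in G$, $|g|_B$ is the length of a shortest word over $B^{\pm1}$ representing $g$. For a finitely generated subgroup $H$ of $G$ with finite generating set $X$, a distortion function of $H$ in $G$ is a non-decreasing $f:\mathbb N\to\mathbb N$ with $|g|_X\le f(|g|_B)$ for all $g\in H$. $H$ has linear distortion in $G$ if there is a constant $C>0$ with $|g|_X\le C\,|g|_B$ for all $g\in H$ (this does not depend on the choice of the finite generating sets). The Thompson group $V$: let $A=\{a,b\}$. A right ideal of the free monoid $A^*$ is a subset $R$ with $RA^*\subseteq R$; it is essential if it meets every (non-empty) right ideal, and finitely generated if $R=PA^*$ with $P$ finite. A right-ideal isomorphism is a bijection $\varphi:R_1\to R_2$ between right ideals with $\varphi(ux)=\varphi(u)x$ for $u\in R_1$, $x\in A^*$. Every isomorphism $\varphi$ between essential right ideals has a unique maximum extension $\mathsf{max}\,\varphi$ to a right-ideal isomorphism. $V$ is the group of all maximal isomorphisms between finitely generated essential right ideals of $\{a,b\}^*$, with multiplication $\varphi\cdot\psi=\mathsf{max}(\varphi\circ\psi)$. $V$ is finitely generated. *)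

theory Defs
  imports Complex_Main "HOL-Algebra.Generated_Groups"
begin

section \<open>Word length and linear distortion\<close>

definition word_length :: "('g, 'm) monoid_scheme \<Rightarrow> 'g set \<Rightarrow> 'g \<Rightarrow> nat" where
  "word_length G B g =
     (LEAST n. \<exists>ws. length ws = n \<and> set ws \<subseteq> B \<union> m_inv G ` B \<and>
                    foldr (\<otimes>\<^bsub>G\<^esub>) ws \<one>\<^bsub>G\<^esub> = g)"

definition finite_generating_set :: "('g, 'm) monoid_scheme \<Rightarrow> 'g set \<Rightarrow> 'g set \<Rightarrow> bool" where
  "finite_generating_set G H X \<longleftrightarrow> finite X \<and> X \<subseteq> H \<and> generate G X = H"

text \<open>
  The existential quantifiers over \<open>B\<close> and \<open>X\<close> make finite generation of \<open>G\<close> and of \<open>H\<close> part of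
  the notion; since changing finite generating sets only changes the constant \<open>C\<close>, the choice
  of \<open>B\<close> and \<open>X\<close> is otherwise immaterial.
\<close>

definition linear_distortion :: "('g, 'm) monoid_scheme \<Rightarrow> 'g set \<Rightarrow> bool" where
  "linear_distortion G H \<longleftrightarrow>
     (\<exists>B X. finite_generating_set G (carrier G) B \<and> finite_generating_set G H X \<and>
        (\<exists>C::real. C > 0 \<and>
           (\<forall>g\<in>H. real (word_length G X g) \<le> C * real (word_length G B g))))"

section \<open>Free groups\<close>

text \<open>
  The letter \<open>(x, True)\<close> stands for the generator \<open>x\<close> and \<open>(x, False)\<close> for its formal inverse.
  The elements of the free group are the reduced words; the product of two reduced words is the
  reduced form of their concatenation.
\<close>

definition reduced :: "('x \<times> bool) list \<Rightarrow> bool" where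
  "reduced w \<longleftrightarrow> (\<nexists>u x e v. w = u @ [(x, e), (x, \<not> e)] @ v)"

fun cons_reduce :: "'x \<times> bool \<Rightarrow> ('x \<times> bool) list \<Rightarrow> ('x \<times> bool) list" where
  "cons_reduce l [] = [l]"
| "cons_reduce l (m # w) = (if m = (fst l, \<not> snd l) then w else l # m # w)"

definition free_group :: "'x set \<Rightarrow> ('x \<times> bool) list monoid" where
  "free_group S =
     \<lparr>carrier = {w. fst ` set w \<subseteq> S \<and> reduced w},
      mult = (\<lambda>u v. foldr cons_reduce u v),
      one = []\<rparr>"

definition FG2 :: "(bool \<times> bool) list monoid" where
  "FG2 = free_group (UNIV :: bool set)"

section \<open>The Thompson group \<open>V\<close>\<close>

definition right_ideal :: "'a list set \<Rightarrow> bool" where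
  "right_ideal R \<longleftrightarrow> (\<forall>u\<in>R. \<forall>x. u @ x \<in> R)"

definition essential_right_ideal :: "'a list set \<Rightarrow> bool" where
  "essential_right_ideal R \<longleftrightarrow>
     right_ideal R \<and> (\<forall>S. right_ideal S \<and> S \<noteq> {} \<longrightarrow> R \<inter> S \<noteq> {})"

definition fg_right_ideal :: "'a list set \<Rightarrow> bool" where
  "fg_right_ideal R \<longleftrightarrow> (\<exists>P. finite P \<and> R = {p @ x | p x. p \<in> P})"

text \<open>Isomorphisms between right ideals are represented as partial maps on words.\<close>

definition right_ideal_iso ::
    "('a list \<rightharpoonup> 'a list) \<Rightarrow> 'a list set \<Rightarrow> 'a list set \<Rightarrow> bool" where
  "right_ideal_iso \<phi> R1 R2 \<longleftrightarrow>
     right_ideal R1 \<and> right_ideal R2 \<and>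
     dom \<phi> = R1 \<and> bij_betw (\<lambda>u. the (\<phi> u)) R1 R2 \<and>
     (\<forall>u\<in>R1. \<forall>x. the (\<phi> (u @ x)) = the (\<phi> u) @ x)"

definition max_ext :: "('a list \<rightharpoonup> 'a list) \<Rightarrow> ('a list \<rightharpoonup> 'a list)" where
  "max_ext \<phi> =
     (THE \<psi>. (\<exists>R1 R2. right_ideal_iso \<psi> R1 R2) \<and> \<phi> \<subseteq>\<^sub>m \<psi> \<and>
            (\<forall>\<chi> R1 R2. right_ideal_iso \<chi> R1 R2 \<and> \<phi> \<subseteq>\<^sub>m \<chi> \<longrightarrow> \<chi> \<subseteq>\<^sub>m \<psi>))"

definition maximal_iso :: "('a list \<rightharpoonup> 'a list) \<Rightarrow> bool" where
  "maximal_iso \<phi> \<longleftrightarrow>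
     (\<forall>\<chi> R1 R2. right_ideal_iso \<chi> R1 R2 \<and> \<phi> \<subseteq>\<^sub>m \<chi> \<longrightarrow> \<chi> = \<phi>)"

text \<open>The two letters of the alphabet are the two elements of \<^typ>\<open>bool\<close>.\<close>

definition thompson_V :: "(bool list \<rightharpoonup> bool list) monoid" where
  "thompson_V =
     \<lparr>carrier = {\<phi>. maximal_iso \<phi> \<and>
        (\<exists>R1 R2. right_ideal_iso \<phi> R1 R2 \<and>
           essential_right_ideal R1 \<and> fg_right_ideal R1 \<and>
           essential_right_ideal R2 \<and> fg_right_ideal R2)},
      mult = (\<lambda>\<phi> \<psi>. max_ext (\<phi> \<circ>\<^sub>m \<psi>)),
      one = Some\<rparr>"

end

theory Submission
  imports Defs "HOL-Library.Stream"
begin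

text \<open>
  An element of \<open>V\<close> is determined by its action on infinite words, where it replaces prefixes:
  the maximal extension of an isomorphism is the set of all prefix replacements that its action
  performs. The amount by which a map lengthens the replaced prefix is subadditive, hence bounded
  by a multiple of the word length in \<open>V\<close>. A pair of ping-pong generators is chosen such that each
  letter of a reduced word lengthens a suitable prefix by at least one; the free group that they
  generate is therefore undistorted. Two copies of it, acting below the words \<open>[True]\<close> and
  \<open>[False]\<close>, give the direct product.
\<close>

section \<open>Prefix replacements on infinite binary words\<close>

text \<open>Multiplication in \<open>thompson_V\<close> is a maximal extension chosen by a
  description, which makes associativity and inverses awkward; on infinite words the product is
  plain composition, and \<open>germ\<close> carries the group structure over. Two kinds of
  cancellation stand in the way of a length estimate. A composite may replace a prefix that is too
  short for its first factor to replace; padding the prefix cures this. And every letter of the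
  ping-pong pair shortens some prefixes. So a single prefix is followed: it starts outside the cones
  of the generator that acts first, and in a reduced word no later letter meets it in a cone that
  this letter shortens. The four words of length 2 provide one cone \<open>[x, e]\<close> for each
  letter \<open>(x, e)\<close>. Linear distortion asks for a finite generating set of the whole
  group, so finite generation has to be proved too; transpositions of disjoint cones turn it into a
  reduction of prefix codes. The length of a reduced word is at most the growth of its image, hence
  the factor 1 for the free group. In the product each coordinate is bounded by the growth
  separately, hence the factor 2.\<close>

definition replaces :: "(bool stream \<Rightarrow> bool stream) \<Rightarrow> bool list \<Rightarrow> bool list \<Rightarrow> bool" where
  "replaces f u v \<longleftrightarrow> (\<forall>z. f (u @- z) = v @- z)"

text \<open>The depth \<open>n\<close> is demanded on the domain side only; for the inverse a depth
  is recovered from the longest replacing word.\<close>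

definition cantor_V :: "(bool stream \<Rightarrow> bool stream) monoid" where
  "cantor_V =
     \<lparr>carrier = {f. bij f \<and> (\<exists>n. \<forall>u. length u = n \<longrightarrow> (\<exists>v. replaces f u v))},
      mult = (\<circ>), one = id\<rparr>"

lemma shift_eq_cases:
  assumes "u @- z = v @- w"
  obtains x where "v = u @ x" "z = x @- w" | x where "u = v @ x" "w = x @- z"
  using assms
proof (induction u arbitrary: v thesis)
  case Nil
  then show ?case by auto
next
  case (Cons a u)
  show ?case
  proof (cases v)
    case Nil
    then show ?thesis using Cons.prems(2)[of "a # u"] Cons.prems(3) by auto
  next
    case (Cons b v')
    then have "a = b" "u @- z = v' @- w" using Cons.prems(3) by auto
    then show ?thesis using Cons.IH[of v'] Cons.prems(1,2) Cons by (metis append_Cons)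
  qed
qed

lemma shift_append_cases:
  assumes "u @- z = v @- w" "length u \<le> length v"
  obtains x where "v = u @ x" "z = x @- w"
  using assms(2) by (rule_tac shift_eq_cases[OF assms(1)]) auto

lemma replaces_append: "replaces f u v \<Longrightarrow> replaces f (u @ x) (v @ x)"
  by (simp add: replaces_def)

lemma replaces_comp: "replaces g u v \<Longrightarrow> replaces f v w \<Longrightarrow> replaces (f \<circ> g) u w"
  by (simp add: replaces_def)

lemma replaces_id: "replaces id u u"
  by (simp add: replaces_def)

text \<open>One of the two words extends the other, say by \<open>x\<close>, and then prepending
  \<open>x\<close> fixes every stream. A nonempty \<open>x\<close> does not fix the constant stream
  of the letter opposite to its head.\<close>

lemma shift_all_eq:
  assumes "\<And>z :: bool stream. u @- z = v @- z"
  shows "u = v"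
proof -
  have *: "x = []" if "\<And>z :: bool stream. x @- z = z" for x
  proof (cases x)
    case (Cons a y)
    then show ?thesis using arg_cong[OF that[of "sconst (\<not> a)"], of shd] by simp
  qed
  show ?thesis
  proof (cases "length u \<le> length v")
    case True
    obtain x where x: "v = u @ x"
      using shift_append_cases[OF assms True] .
    then have "\<And>z :: bool stream. x @- z = z" using assms by simp
    then show ?thesis using * x by simp
  next
    case False
    then have "length v \<le> length u" by simp
    from shift_append_cases[OF assms[symmetric] this]
    obtain x where x: "u = v @ x" .
    then have "\<And>z :: bool stream. x @- z = z" using assms by simp
    then show ?thesis using * x by simp
  qed
qed

lemma replaces_unique: "replaces f u v \<Longrightarrow> replaces f u w \<Longrightarrow> v = w"
  by (rule shift_all_eq) (simp add: replaces_def)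

text \<open>The depth \<open>n\<close> may depend on \<open>z\<close>: replacements of longer
  prefixes glue as soon as they all arise from the same pair \<open>u\<close>, \<open>v\<close>.
  This is the reason why maximal extensions can be computed from the action on streams.\<close>

lemma replaces_extend:
  assumes "\<And>z. \<exists>n. replaces f (u @ stake n z) (v @ stake n z)"
  shows "replaces f u v"
  unfolding replaces_def
proof
  fix z
  obtain n where "replaces f (u @ stake n z) (v @ stake n z)" using assms by blast
  then have "f ((u @ stake n z) @- sdrop n z) = (v @ stake n z) @- sdrop n z"
    by (simp only: replaces_def)
  then show "f (u @- z) = v @- z" by (simp add: stake_sdrop)
qed

lemma replaces_inv: "bij f \<Longrightarrow> replaces (Hilbert_Choice.inv f) v u \<longleftrightarrow> replaces f u v"
  unfolding replaces_def by (metis bij_inv_eq_iff)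

lemma replaces_long:
  assumes "\<And>u. length u = n \<Longrightarrow> \<exists>v. replaces f u v" "n \<le> length u"
  shows "\<exists>v. replaces f u v"
proof -
  obtain v where "replaces f (take n u) v" using assms by fastforce
  then show ?thesis using replaces_append[of f "take n u" v "drop n u"] by auto
qed

lemma cantor_VE:
  assumes "f \<in> carrier cantor_V"
  obtains n where "\<And>u. n \<le> length u \<Longrightarrow> \<exists>v. replaces f u v"
  using assms replaces_long unfolding cantor_V_def by auto metis

lemma cantor_V_bij: "f \<in> carrier cantor_V \<Longrightarrow> bij f"
  by (simp add: cantor_V_def)

lemma cantor_VI:
  "bij f \<Longrightarrow> (\<And>u. length u = n \<Longrightarrow> \<exists>v. replaces f u v) \<Longrightarrow> f \<in> carrier cantor_V"
  by (auto simp: cantor_V_def)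

lemma mult_cantor_V [simp]: "(\<otimes>\<^bsub>cantor_V\<^esub>) = (\<circ>)"
  and one_cantor_V [simp]: "\<one>\<^bsub>cantor_V\<^esub> = id"
  by (simp_all add: cantor_V_def)

lemma finite_words: "finite {u :: bool list. length u = n}"
  using finite_lists_length_eq[of "UNIV :: bool set" n] by simp

lemma finite_words_le: "finite {u :: bool list. length u \<le> n}"
  using finite_lists_length_le[of "UNIV :: bool set" n] by simp

lemma bounded_replacement:
  assumes "\<And>u. length u = n \<Longrightarrow> \<exists>v. replaces f u v"
  obtains m where "\<And>u. length u = n \<Longrightarrow> \<exists>v. replaces f u v \<and> length v \<le> m"
proof -
  obtain q where q: "\<And>u. length u = n \<Longrightarrow> replaces f u (q u)" using assms by metis
  let ?S = "(\<lambda>u. length (q u)) ` {u. length u = n}"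
  have "length (q u) \<le> Max ?S" if "length u = n" for u
    using that finite_words by (intro Max_ge) auto
  then show ?thesis using that q by blast
qed

text \<open>Let \<open>m\<close> bound the images of all words of length \<open>n\<close>. For a
  word \<open>w\<close> of length \<open>m\<close>, pull back any stream that starts with
  \<open>w\<close>: the image of the first \<open>n\<close> letters of the preimage is at most
  \<open>m\<close> long and therefore a prefix of \<open>w\<close>.\<close>

lemma inv_in_cantor_V:
  assumes "f \<in> carrier cantor_V"
  shows "Hilbert_Choice.inv f \<in> carrier cantor_V"
proof -
  have bij: "bij f" using assms by (rule cantor_V_bij)
  obtain n where "\<And>u. n \<le> length u \<Longrightarrow> \<exists>v. replaces f u v" using cantor_VE[OF assms] by blast
  then obtain m where m: "\<And>u. length u = n \<Longrightarrow> \<exists>v. replaces f u v \<and> length v \<le> m"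
    using bounded_replacement[of n f] by auto
  have "\<exists>v. replaces (Hilbert_Choice.inv f) w v" if w: "length w = m" for w
  proof -
    define z :: "bool stream" where "z = Hilbert_Choice.inv f (w @- sconst True)"
    obtain v where v: "replaces f (stake n z) v" "length v \<le> m" using m[of "stake n z"] by auto
    then have "f (stake n z @- sdrop n z) = v @- sdrop n z" by (simp add: replaces_def)
    then have "v @- sdrop n z = w @- sconst True"
      using bij by (simp add: stake_sdrop z_def bij_inv_eq_iff bij_is_surj surj_f_inv_f)
    then obtain x where "w = v @ x"
      by (rule shift_append_cases) (use v w in auto)
    then show ?thesis using replaces_append[OF v(1), of x] bij by (auto simp: replaces_inv)
  qed
  then show ?thesis using bij by (intro cantor_VI) (auto simp: bij_imp_bij_inv)
qed

lemma comp_in_cantor_V: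
  assumes "f \<in> carrier cantor_V" "g \<in> carrier cantor_V"
  shows "f \<circ> g \<in> carrier cantor_V"
proof -
  obtain n where n: "\<And>u. n \<le> length u \<Longrightarrow> \<exists>v. replaces f u v" using cantor_VE[OF assms(1)] by blast
  obtain m where m: "\<And>u. m \<le> length u \<Longrightarrow> \<exists>v. replaces g u v" using cantor_VE[OF assms(2)] by blast
  \<comment> \<open>The map \<open>g\<close> may shrink the first \<open>m\<close> letters, even to
    the empty word, but the other \<open>n\<close> letters survive and suffice for
    \<open>f\<close>.\<close>
  have "\<exists>v. replaces (f \<circ> g) u v" if u: "length u = m + n" for u
  proof -
    obtain v where "replaces g (take m u) v" using m[of "take m u"] u by auto
    then have 1: "replaces g u (v @ drop m u)"
      using replaces_append[of g "take m u" v "drop m u"] by simp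
    obtain w where "replaces f (v @ drop m u) w" using n[of "v @ drop m u"] u by auto
    then show ?thesis using replaces_comp[OF 1] by blast
  qed
  then show ?thesis using assms by (intro cantor_VI) (auto simp: cantor_V_bij bij_comp)
qed

lemma id_in_cantor_V: "id \<in> carrier cantor_V"
  by (rule cantor_VI[of _ 0]) (auto intro: replaces_id)

lemma group_cantor_V: "group cantor_V"
proof (rule groupI)
  fix f assume "f \<in> carrier cantor_V"
  then show "\<exists>g\<in>carrier cantor_V. g \<otimes>\<^bsub>cantor_V\<^esub> f = \<one>\<^bsub>cantor_V\<^esub>"
    by (intro bexI[of _ "Hilbert_Choice.inv f"]) (auto simp: inv_in_cantor_V cantor_V_bij bij_is_inj)
qed (auto simp: comp_in_cantor_V id_in_cantor_V o_assoc)

interpretation cantor_V: group cantor_V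
  by (rule group_cantor_V)

section \<open>Germs: the Thompson group acting on infinite words\<close>

text \<open>This turns out to be the maximal right-ideal isomorphism that induces \<open>f\<close>;
  the description is well defined by \<open>replaces_unique\<close>.\<close>

definition germ :: "(bool stream \<Rightarrow> bool stream) \<Rightarrow> bool list \<rightharpoonup> bool list" where
  "germ f u = (if \<exists>v. replaces f u v then Some (THE v. replaces f u v) else None)"

lemma germ_eq_Some: "germ f u = Some v \<longleftrightarrow> replaces f u v"
proof (cases "\<exists>w. replaces f u w")
  case True
  then obtain w where w: "replaces f u w" ..
  then have "(THE v. replaces f u v) = w" by (rule the_equality) (rule replaces_unique[OF _ w])
  then have "germ f u = Some w" using w by (auto simp: germ_def)
  then show ?thesis using w replaces_unique by (metis option.inject)
qed (auto simp: germ_def)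

lemma the_germ: "replaces f u v \<Longrightarrow> the (germ f u) = v"
  by (simp add: germ_eq_Some[symmetric])

lemma map_le_germI:
  assumes "\<And>u v. \<chi> u = Some v \<Longrightarrow> replaces f u v"
  shows "\<chi> \<subseteq>\<^sub>m germ f"
  unfolding map_le_def using assms germ_eq_Some by (metis domD)

lemma dom_germ: "dom (germ f) = {u. \<exists>v. replaces f u v}"
  by (auto simp: dom_def germ_eq_Some)

lemma right_ideal_dom_germ: "right_ideal (dom (germ f))"
  unfolding right_ideal_def dom_germ using replaces_append by blast

lemma dom_germ_essential_fg:
  assumes "f \<in> carrier cantor_V"
  shows "essential_right_ideal (dom (germ f))" "fg_right_ideal (dom (germ f))"
proof -
  obtain n where n: "\<And>u. n \<le> length u \<Longrightarrow> u \<in> dom (germ f)"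
    unfolding dom_germ using cantor_VE[OF assms] by auto
  show "essential_right_ideal (dom (germ f))"
    unfolding essential_right_ideal_def
  proof (intro conjI allI impI)
    fix S :: "bool list set" assume S: "right_ideal S \<and> S \<noteq> {}"
    then obtain s where "s \<in> S" by blast
    then have "s @ replicate n True \<in> S" using S by (auto simp: right_ideal_def)
    moreover have "s @ replicate n True \<in> dom (germ f)" by (rule n) simp
    ultimately show "dom (germ f) \<inter> S \<noteq> {}" by blast
  qed (rule right_ideal_dom_germ)
  define P where "P = {u \<in> dom (germ f). length u \<le> n}"
  have "finite P" unfolding P_def using finite_words_le[of n] by (rule rev_finite_subset) auto
  moreover have "dom (germ f) = {p @ x | p x. p \<in> P}"
  proof (intro Set.set_eqI iffI)
    fix u assume u: "u \<in> dom (germ f)"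
    have "\<exists>p x. u = p @ x \<and> p \<in> P"
    proof (cases "length u \<le> n")
      case True
      then show ?thesis using u by (intro exI[of _ u] exI[of _ "[]"]) (auto simp: P_def)
    next
      case False
      have "u = take n u @ drop n u" "take n u \<in> P"
        using False by (auto simp: P_def intro!: n simp del: domIff)
      then show ?thesis by blast
    qed
    then show "u \<in> {p @ x | p x. p \<in> P}" by blast
  next
    fix u assume "u \<in> {p @ x | p x. p \<in> P}"
    then show "u \<in> dom (germ f)" using right_ideal_dom_germ[of f]
      by (auto simp: P_def right_ideal_def simp del: domIff)
  qed
  ultimately show "fg_right_ideal (dom (germ f))" unfolding fg_right_ideal_def by blast
qed

lemma right_ideal_iso_germ:
  assumes "bij f"
  shows "right_ideal_iso (germ f) (dom (germ f)) (dom (germ (Hilbert_Choice.inv f)))"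
proof -
  note the = the_germ
  show ?thesis
    unfolding right_ideal_iso_def
  proof (intro conjI ballI allI)
    show "bij_betw (\<lambda>u. the (germ f u)) (dom (germ f)) (dom (germ (Hilbert_Choice.inv f)))"
    proof (rule bij_betw_byWitness[where f' = "\<lambda>v. the (germ (Hilbert_Choice.inv f) v)"])
      have *: "the (germ (Hilbert_Choice.inv f) v) = u" if "replaces f u v" for u v
        using that by (intro the_germ) (simp add: replaces_inv[OF assms])
      show "\<forall>u\<in>dom (germ f). the (germ (Hilbert_Choice.inv f) (the (germ f u))) = u"
        using * the by (auto simp: dom_germ simp del: domIff)
      show "\<forall>v\<in>dom (germ (Hilbert_Choice.inv f)). the (germ f (the (germ (Hilbert_Choice.inv f) v))) = v"
        using * the by (auto simp: dom_germ replaces_inv[OF assms] simp del: domIff)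
      show "(\<lambda>u. the (germ f u)) ` dom (germ f) \<subseteq> dom (germ (Hilbert_Choice.inv f))"
        using the by (auto simp: dom_germ replaces_inv[OF assms] simp del: domIff)
      show "(\<lambda>v. the (germ (Hilbert_Choice.inv f) v)) ` dom (germ (Hilbert_Choice.inv f)) \<subseteq> dom (germ f)"
        using * by (auto simp: dom_germ replaces_inv[OF assms] simp del: domIff)
    qed
    fix u x assume "u \<in> dom (germ f)"
    then obtain v where "replaces f u v" by (auto simp: dom_germ simp del: domIff)
    then show "the (germ f (u @ x)) = the (germ f u) @ x"
      using the[OF replaces_append] the by simp
  qed (simp_all add: right_ideal_dom_germ)
qed

lemma right_ideal_iso_append:
  assumes "right_ideal_iso \<phi> R1 R2" "\<phi> u = Some v"
  shows "\<phi> (u @ x) = Some (v @ x)"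
proof -
  have "u \<in> R1" "u @ x \<in> R1"
    using assms by (auto simp: right_ideal_iso_def right_ideal_def)
  then have "the (\<phi> (u @ x)) = the (\<phi> u) @ x" "u @ x \<in> dom \<phi>"
    using assms(1) by (auto simp: right_ideal_iso_def)
  then show ?thesis using assms(2) by auto
qed

text \<open>Every word of \<open>dom \<chi>\<close> can be prolonged along any stream into
  \<open>dom \<phi>\<close>, where \<open>\<chi>\<close> agrees with \<open>f\<close>;
  \<open>replaces_extend\<close> removes the prolongation again. With \<open>\<phi> = germ f\<close>
  this gives maximality, with a composite of germs it computes \<open>max_ext\<close>.\<close>

lemma extension_le_germ:
  assumes \<phi>: "\<phi> \<subseteq>\<^sub>m germ f" "\<And>z. \<exists>n. stake n z \<in> dom \<phi>"
    and app: "\<And>u x. u \<in> dom \<phi> \<Longrightarrow> u @ x \<in> dom \<phi>"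
    and \<chi>: "right_ideal_iso \<chi> R1 R2" "\<phi> \<subseteq>\<^sub>m \<chi>"
  shows "\<chi> \<subseteq>\<^sub>m germ f"
proof -
  have "replaces f u v" if "\<chi> u = Some v" for u v
  proof (rule replaces_extend)
    fix z
    obtain n where "stake n (u @- z) \<in> dom \<phi>" using \<phi>(2) by blast
    \<comment> \<open>The prefix found may be shorter than \<open>u\<close>; a further
      \<open>length u\<close> letters turn it into an extension of \<open>u\<close>.\<close>
    then have "stake n (u @- z) @ stake (length u) (sdrop n (u @- z)) \<in> dom \<phi>" by (rule app)
    moreover have "stake n (u @- z) @ stake (length u) (sdrop n (u @- z)) = stake (length u + n) (u @- z)"
      by (simp only: stake_add add.commute)
    moreover have "stake (length u + n) (u @- z) = u @ stake n z" by (simp add: stake_shift)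
    ultimately have "u @ stake n z \<in> dom \<phi>" by simp
    then have "\<phi> (u @ stake n z) = \<chi> (u @ stake n z)" "\<phi> (u @ stake n z) = germ f (u @ stake n z)"
      using \<phi>(1) \<chi>(2) unfolding map_le_def by blast+
    moreover have "\<chi> (u @ stake n z) = Some (v @ stake n z)"
      using right_ideal_iso_append[OF \<chi>(1) that] .
    ultimately show "\<exists>n. replaces f (u @ stake n z) (v @ stake n z)"
      by (auto simp: germ_eq_Some)
  qed
  then show ?thesis by (rule map_le_germI)
qed

lemma germ_dense:
  assumes "f \<in> carrier cantor_V"
  shows "\<exists>n. stake n z \<in> dom (germ f)"
proof -
  obtain n where "\<And>u. n \<le> length u \<Longrightarrow> \<exists>v. replaces f u v" using cantor_VE[OF assms] by blast
  then show ?thesis by (intro exI[of _ n]) (auto simp: dom_germ simp del: domIff)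
qed

lemma germ_dom_append: "u \<in> dom (germ f) \<Longrightarrow> u @ x \<in> dom (germ f)"
  using right_ideal_dom_germ by (auto simp: right_ideal_def)

lemma germ_in_thompson_V:
  assumes f: "f \<in> carrier cantor_V"
  shows "germ f \<in> carrier thompson_V"
proof -
  have "\<chi> = germ f" if "right_ideal_iso \<chi> R1 R2" "germ f \<subseteq>\<^sub>m \<chi>" for \<chi> R1 R2
    using extension_le_germ[OF _ germ_dense[OF f] germ_dom_append that] that(2)
    by (simp add: map_le_antisym)
  then have "maximal_iso (germ f)" by (auto simp: maximal_iso_def)
  then show ?thesis
    using right_ideal_iso_germ[OF cantor_V_bij[OF f]] dom_germ_essential_fg[OF f]
      dom_germ_essential_fg[OF inv_in_cantor_V[OF f]]
    unfolding thompson_V_def by auto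
qed

text \<open>The composite of the germs may miss words that \<open>f \<circ> g\<close> replaces, but
  its domain contains a prefix of every stream. So every extension of it, the largest one included,
  stays below \<open>germ (f \<circ> g)\<close>.\<close>

lemma germ_comp:
  assumes f: "f \<in> carrier cantor_V" and g: "g \<in> carrier cantor_V"
  shows "germ (f \<circ> g) = germ f \<otimes>\<^bsub>thompson_V\<^esub> germ g"
proof -
  let ?\<phi> = "germ f \<circ>\<^sub>m germ g"
  have \<phi>: "?\<phi> u = Some w \<longleftrightarrow> (\<exists>v. replaces g u v \<and> replaces f v w)" for u w
    by (auto simp: map_comp_Some_iff germ_eq_Some)
  have le: "?\<phi> \<subseteq>\<^sub>m germ (f \<circ> g)"
    by (rule map_le_germI) (use \<phi> replaces_comp in blast)
  have app: "u @ x \<in> dom ?\<phi>" if "u \<in> dom ?\<phi>" for u x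
    using that replaces_append unfolding dom_def mem_Collect_eq not_None_eq \<phi> by meson
  have dense: "\<exists>n. stake n z \<in> dom ?\<phi>" for z
  proof -
    obtain n where n: "\<And>u. n \<le> length u \<Longrightarrow> \<exists>v. replaces f u v" using cantor_VE[OF f] by blast
    obtain m where m: "\<And>u. m \<le> length u \<Longrightarrow> \<exists>v. replaces g u v" using cantor_VE[OF g] by blast
    obtain v where "replaces g (stake m z) v" using m[of "stake m z"] by auto
    then have "replaces g (stake (m + n) z) (v @ stake n (sdrop m z))"
      using replaces_append[of g "stake m z" v "stake n (sdrop m z)"] by (simp add: stake_add)
    moreover obtain w where "replaces f (v @ stake n (sdrop m z)) w"
      using n[of "v @ stake n (sdrop m z)"] by auto
    ultimately have "?\<phi> (stake (m + n) z) = Some w" by (auto simp: \<phi>)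
    then show ?thesis by blast
  qed
  have "max_ext ?\<phi> = germ (f \<circ> g)"
    unfolding max_ext_def
  proof (rule the_equality)
    have iso: "\<exists>R1 R2. right_ideal_iso (germ (f \<circ> g)) R1 R2"
      using right_ideal_iso_germ[OF cantor_V_bij[OF comp_in_cantor_V[OF f g]]] by blast
    then show "(\<exists>R1 R2. right_ideal_iso (germ (f \<circ> g)) R1 R2) \<and> ?\<phi> \<subseteq>\<^sub>m germ (f \<circ> g) \<and>
        (\<forall>\<chi> R1 R2. right_ideal_iso \<chi> R1 R2 \<and> ?\<phi> \<subseteq>\<^sub>m \<chi> \<longrightarrow> \<chi> \<subseteq>\<^sub>m germ (f \<circ> g))"
      using le extension_le_germ[OF le dense app] by blast
    fix \<psi> assume "(\<exists>R1 R2. right_ideal_iso \<psi> R1 R2) \<and> ?\<phi> \<subseteq>\<^sub>m \<psi> \<and>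
        (\<forall>\<chi> R1 R2. right_ideal_iso \<chi> R1 R2 \<and> ?\<phi> \<subseteq>\<^sub>m \<chi> \<longrightarrow> \<chi> \<subseteq>\<^sub>m \<psi>)"
    then show "\<psi> = germ (f \<circ> g)"
      using iso le extension_le_germ[OF le dense app] by (meson map_le_antisym)
  qed
  then show ?thesis by (simp add: thompson_V_def)
qed

text \<open>The ideal generated by \<open>u\<close> meets \<open>R\<close>, so some generator of
  \<open>R\<close> is comparable with \<open>u\<close>; if \<open>u\<close> is at least as long as
  all generators, that generator is a prefix of \<open>u\<close>.\<close>

lemma essential_fg_contains_long_words:
  assumes "essential_right_ideal R" "fg_right_ideal R"
  obtains n where "\<And>u. n \<le> length u \<Longrightarrow> u \<in> R"
proof -
  obtain P where P: "finite P" "R = {p @ x | p x. p \<in> P}"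
    using assms(2) by (auto simp: fg_right_ideal_def)
  define n where "n = Max (length ` P)"
  have n: "length p \<le> n" if "p \<in> P" for p using that P(1) by (simp add: n_def)
  have "u \<in> R" if u: "n \<le> length u" for u
  proof -
    have "right_ideal {u @ x | x. True}" by (auto simp: right_ideal_def)
    moreover have "u @ [] \<in> {u @ x | x. True}" by blast
    ultimately have "R \<inter> {u @ x | x. True} \<noteq> {}"
      using assms(1) unfolding essential_right_ideal_def by blast
    then obtain p x y where p: "p \<in> P" "u @ y = p @ x" using P(2) by auto
    then have "length p \<le> length u" using n u by fastforce
    then have "u = p @ drop (length p) u" using p(2)
      by (metis append_eq_append_conv_if append_take_drop_id)
    then show ?thesis using p(1) P(2) by blast
  qed
  then show ?thesis using that by blast
qed

lemma thompson_V_germ: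
  assumes "\<phi> \<in> carrier thompson_V"
  shows "\<exists>f\<in>carrier cantor_V. germ f = \<phi>"
proof -
  obtain R1 R2 where max: "maximal_iso \<phi>" and iso: "right_ideal_iso \<phi> R1 R2"
    and R1: "essential_right_ideal R1" "fg_right_ideal R1"
    and R2: "essential_right_ideal R2" "fg_right_ideal R2"
    using assms by (auto simp: thompson_V_def)
  have dom: "dom \<phi> = R1" and bij: "bij_betw (\<lambda>u. the (\<phi> u)) R1 R2"
    using iso by (auto simp: right_ideal_iso_def)
  note app = right_ideal_iso_append[OF iso]
  obtain n where n: "\<And>u. n \<le> length u \<Longrightarrow> u \<in> R1"
    using essential_fg_contains_long_words[OF R1] by blast
  obtain m where m: "\<And>u. m \<le> length u \<Longrightarrow> u \<in> R2"
    using essential_fg_contains_long_words[OF R2] by blast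
  define f where "f z = the (\<phi> (stake n z)) @- sdrop n z" for z
  \<comment> \<open>A word of the domain may have fewer than \<open>n\<close> letters. Padded by
    \<open>stake n z\<close> it has a prefix of length \<open>n\<close>, and the two ways to
    evaluate \<open>\<phi>\<close> on the padded word agree.\<close>
  have rep: "replaces f u v" if "\<phi> u = Some v" for u v
  proof (rule replaces_extend)
    fix z
    have "replaces f (u @ stake n z) (v @ stake n z)"
      unfolding replaces_def
    proof
      fix y
      let ?w = "u @ stake n z"
      obtain v' where v': "\<phi> (take n ?w) = Some v'" using n[of "take n ?w"] dom by fastforce
      have "\<phi> (take n ?w @ drop n ?w) = Some (v' @ drop n ?w)" using app[OF v'] .
      moreover have "\<phi> ?w = Some (v @ stake n z)" using app[OF that] .
      ultimately have eq: "v' @ drop n ?w = v @ stake n z"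
        unfolding append_take_drop_id by (metis option.inject)
      have "stake n (?w @- y) = take n ?w" "sdrop n (?w @- y) = drop n ?w @- y"
        by (simp_all add: stake_shift sdrop_shift)
      then have "f (?w @- y) = v' @- drop n ?w @- y" by (simp only: f_def v' option.sel)
      then show "f (?w @- y) = (v @ stake n z) @- y" by (simp only: eq[symmetric] shift_append)
    qed
    then show "\<exists>n. replaces f (u @ stake n z) (v @ stake n z)" by blast
  qed
  have inj\<phi>: "u = u'" if "\<phi> u = Some v" "\<phi> u' = Some v" for u u' v
    using bij_betw_imp_inj_on[OF bij] that dom by (metis domI inj_onD)
  have "inj f"
  proof (rule injI)
    fix y z assume eq: "f y = f z"
    obtain u v where uv: "\<phi> (stake n y) = Some u" "\<phi> (stake n z) = Some v"
      using n[of "stake n y"] n[of "stake n z"] dom by auto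
    then have "u @- sdrop n y = v @- sdrop n z" using eq by (simp add: f_def)
    then show "y = z"
    \<comment> \<open>One image word extends the other, hence by injectivity of
      \<open>\<phi>\<close> so do the preimages; as these have equal length, the extension is
      empty.\<close>
    proof (cases rule: shift_eq_cases)
      case (1 x)
      then have eq2: "stake n y @ x = stake n z" using inj\<phi> app[OF uv(1)] uv(2) by blast
      have "x = []" using arg_cong[OF eq2, of length] by simp
      then have "stake n y = stake n z" "sdrop n y = sdrop n z" using eq2 1 by simp_all
      then show ?thesis using stake_sdrop by metis
    next
      case (2 x)
      then have eq2: "stake n z @ x = stake n y" using inj\<phi> app[OF uv(2)] uv(1) by blast
      have "x = []" using arg_cong[OF eq2, of length] by simp
      then have "stake n y = stake n z" "sdrop n y = sdrop n z" using eq2 2 by simp_all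
      then show ?thesis using stake_sdrop by metis
    qed
  qed
  moreover have "surj f"
    unfolding surj_def
  proof
    fix w
    have "stake m w \<in> R2" by (rule m) simp
    then obtain u where "u \<in> R1" "the (\<phi> u) = stake m w"
      using bij by (auto simp: bij_betw_def)
    then have "replaces f u (stake m w)" using rep dom by force
    then have "f (u @- sdrop m w) = w" by (simp add: replaces_def stake_sdrop)
    then show "\<exists>z. w = f z" by metis
  qed
  ultimately have bijf: "bij f" by (simp add: bij_def)
  have f: "f \<in> carrier cantor_V"
  proof (rule cantor_VI[OF bijf])
    fix u :: "bool list" assume "length u = n"
    then have "u \<in> dom \<phi>" using n dom by simp
    then show "\<exists>v. replaces f u v" using rep by blast
  qed
  have "\<phi> \<subseteq>\<^sub>m germ f" using rep by (rule map_le_germI)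
  then have "germ f = \<phi>"
    using max right_ideal_iso_germ[OF bijf] unfolding maximal_iso_def by blast
  then show ?thesis using f by blast
qed

lemma inj_on_germ: "inj_on germ (carrier cantor_V)"
proof (rule inj_onI, rule ext)
  fix f g z assume f: "f \<in> carrier cantor_V" and eq: "germ f = germ g"
  obtain n v where "germ f (stake n z) = Some v" using germ_dense[OF f] by blast
  then have "replaces f (stake n z) v" "replaces g (stake n z) v" using eq by (simp_all add: germ_eq_Some[symmetric])
  then show "f z = g z" unfolding replaces_def by (metis stake_sdrop)
qed

lemma germ_iso: "germ \<in> iso cantor_V thompson_V"
  using germ_in_thompson_V thompson_V_germ inj_on_germ
  by (auto simp: iso_def bij_betw_def hom_def germ_comp)

lemma germ_id: "germ id = \<one>\<^bsub>thompson_V\<^esub>"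
proof
  fix u
  have "germ id u = Some u" by (simp add: germ_eq_Some replaces_id)
  then show "germ id u = \<one>\<^bsub>thompson_V\<^esub> u" by (simp add: thompson_V_def)
qed

text \<open>The group axioms are not checked for \<open>max_ext\<close>; they are inherited from
  \<open>cantor_V\<close> along the surjective homomorphism \<open>germ\<close>.\<close>

lemma group_thompson_V: "group thompson_V"
proof -
  have "germ ` carrier cantor_V = carrier thompson_V"
    using germ_iso by (simp add: iso_def bij_betw_def)
  moreover have "germ \<in> hom cantor_V thompson_V" using germ_iso by (simp add: iso_def)
  ultimately show ?thesis
    using cantor_V.hom_imp_img_group[of germ thompson_V] by (simp add: germ_id)
qed

section \<open>Finite generation by swaps of cones\<close>

definition incomparable :: "'a list \<Rightarrow> 'a list \<Rightarrow> bool" where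
  "incomparable u v \<longleftrightarrow> (\<forall>x y. u @ x \<noteq> v @ y)"

definition swap :: "'a list \<Rightarrow> 'a list \<Rightarrow> 'a stream \<Rightarrow> 'a stream" where
  "swap u v z =
     (if z \<in> range ((@-) u) then v @- sdrop (length u) z
      else if z \<in> range ((@-) v) then u @- sdrop (length v) z else z)"

lemma incomparable_sym: "incomparable u v \<longleftrightarrow> incomparable v u"
  unfolding incomparable_def by metis

lemma incomparable_append: "incomparable u v \<Longrightarrow> incomparable (u @ x) v"
  by (simp add: incomparable_def)

lemma incomparable_append_cancel: "incomparable (s @ u) (s @ v) \<longleftrightarrow> incomparable u v"
  by (simp add: incomparable_def)

lemma not_incomparable: "\<not> incomparable u v \<longleftrightarrow> (\<exists>x. v = u @ x) \<or> (\<exists>x. u = v @ x)"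
  unfolding incomparable_def by (metis append_Nil2 append_eq_append_conv2)

lemma incomparable_shift: "incomparable u v \<Longrightarrow> u @- y \<noteq> v @- z"
  by (metis incomparable_def shift_eq_cases append_Nil2)

lemma swap_left: "swap u v (u @- y) = v @- y"
  by (simp add: swap_def sdrop_shift)

lemma swap_right:
  assumes "incomparable u v"
  shows "swap u v (v @- y) = u @- y"
proof -
  have "v @- y \<notin> range ((@-) u)" using incomparable_shift[OF assms] by (metis imageE)
  then show ?thesis by (simp add: swap_def sdrop_shift)
qed

lemma swap_other: "z \<notin> range ((@-) u) \<Longrightarrow> z \<notin> range ((@-) v) \<Longrightarrow> swap u v z = z"
  by (simp add: swap_def)

lemma swap_cases:
  obtains y where "z = u @- y" | y where "z = v @- y"
    | "z \<notin> range ((@-) u)" "z \<notin> range ((@-) v)"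
  by blast

lemma swap_swap: "incomparable u v \<Longrightarrow> swap u v (swap u v z) = z"
  by (rule swap_cases[where z = z and u = u and v = v]) (auto simp: swap_left swap_right swap_other)

lemma swap_commute: "incomparable u v \<Longrightarrow> swap u v = swap v u"
proof
  fix z assume "incomparable u v"
  then show "swap u v z = swap v u z"
    by (rule_tac swap_cases[where z = z and u = u and v = v])
      (auto simp: swap_left swap_right swap_other incomparable_sym[of v u])
qed

lemma bij_swap: "incomparable u v \<Longrightarrow> bij (swap u v)"
  by (rule o_bij[of "swap u v"]) (auto simp: swap_swap fun_eq_iff)

lemma replaces_swap_left: "replaces (swap u v) u v"
  by (simp add: replaces_def swap_left)

lemma replaces_swap_right: "incomparable u v \<Longrightarrow> replaces (swap u v) v u"
  by (simp add: replaces_def swap_right)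

lemma replaces_swap_other:
  assumes "incomparable w u" "incomparable w v"
  shows "replaces (swap u v) w w"
  unfolding replaces_def
  by (intro allI swap_other) (use assms incomparable_shift in blast)+

lemma swap_in_cantor_V:
  assumes uv: "incomparable u v"
  shows "swap u v \<in> carrier cantor_V"
proof (rule cantor_VI[OF bij_swap[OF uv]])
  \<comment> \<open>A word of this length is a proper prefix of neither \<open>u\<close> nor
    \<open>v\<close>: it begins with one of them or is incomparable with both.\<close>
  fix w :: "bool list" assume w: "length w = length u + length v"
  consider "incomparable w u" "incomparable w v" | x where "w = u @ x" | x where "w = v @ x"
    using w not_incomparable[of w u] not_incomparable[of w v] by fastforce
  then show "\<exists>w'. replaces (swap u v) w w'"
  proof cases
    case 1
    then show ?thesis using replaces_swap_other by blast
  next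
    case 2
    then show ?thesis using replaces_append[OF replaces_swap_left] by blast
  next
    case 3
    then show ?thesis using replaces_append[OF replaces_swap_right[OF uv]] by blast
  qed
qed

text \<open>Conjugation carries a transposition of cones to the transposition of the image cones.
  Injectivity of \<open>g\<close> keeps the points outside the two cones outside the image
  cones.\<close>

lemma swap_conjugate:
  assumes "inj g" "replaces g u a" "replaces g v b" "incomparable u v" "incomparable a b"
  shows "g (swap u v z) = swap a b (g z)"
proof (rule swap_cases[where z = z and u = u and v = v])
  fix y assume "z = u @- y"
  then show ?thesis using assms by (simp add: swap_left replaces_def)
next
  fix y assume "z = v @- y"
  then show ?thesis using assms by (simp add: swap_right replaces_def)
next
  assume z: "z \<notin> range ((@-) u)" "z \<notin> range ((@-) v)"
  have "g z \<notin> range ((@-) a)" "g z \<notin> range ((@-) b)"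
    using z assms(1-3) by (auto simp: replaces_def inj_eq) (metis inj_eq rangeI)+
  then show ?thesis using z by (simp add: swap_other)
qed

definition short_swaps :: "(bool stream \<Rightarrow> bool stream) set" where
  "short_swaps = {swap u v | u v. incomparable u v \<and> length u \<le> 3 \<and> length v \<le> 3}"

lemma finite_short_swaps: "finite short_swaps"
proof -
  let ?W = "{u :: bool list. length u \<le> 3}"
  have "short_swaps \<subseteq> (\<lambda>(u, v). swap u v) ` (?W \<times> ?W)"
    by (auto simp: short_swaps_def)
  moreover have "finite (?W \<times> ?W)" using finite_words_le by blast
  ultimately show ?thesis using finite_surj by blast
qed

lemma short_swaps_subset: "short_swaps \<subseteq> carrier cantor_V"
  using swap_in_cantor_V by (auto simp: short_swaps_def)

abbreviation generated :: "(bool stream \<Rightarrow> bool stream) set" where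
  "generated \<equiv> generate cantor_V short_swaps"

lemma generated_comp: "f \<in> generated \<Longrightarrow> g \<in> generated \<Longrightarrow> f \<circ> g \<in> generated"
  using generate.eng[of f cantor_V short_swaps g] by simp

lemma generated_id: "id \<in> generated"
  using generate.one[of cantor_V short_swaps] by simp

text \<open>
  A swap of two long cones is conjugated by a short swap, moving a prefix of length 3 to a word
  of length 2, to a swap of shorter cones.
\<close>

lemma swap_generated:
  fixes u v :: "bool list"
  assumes "incomparable u v"
  shows "swap u v \<in> generated"
  using assms
proof (induction "length u + length v" arbitrary: u v rule: less_induct)
  case less
  have short: "swap u v \<in> generated" if "incomparable u v" "length u \<le> 3" "length v \<le> 3"
    for u v :: "bool list"
    using that by (intro generate.incl) (auto simp: short_swaps_def)
  have reduce: "swap u v \<in> generated"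
    if uv: "incomparable u v" and st: "incomparable s t" "length s = 3" "length t = 2"
      and ab: "replaces (swap s t) u a" "replaces (swap s t) v b" "incomparable a b"
      and IH: "swap a b \<in> generated" for s t u v a b
  proof -
    have "swap u v z = (swap s t \<circ> (swap a b \<circ> swap s t)) z" for z
    proof -
      have "swap s t (swap u v z) = swap a b (swap s t z)"
        using uv ab bij_is_inj[OF bij_swap[OF st(1)]] by (intro swap_conjugate) auto
      then show ?thesis using swap_swap[OF st(1), of "swap u v z"] by simp
    qed
    then have "swap u v = swap s t \<circ> (swap a b \<circ> swap s t)" by blast
    moreover have "swap s t \<in> generated" using st by (intro short) auto
    ultimately show ?thesis using IH by (simp add: generated_comp)
  qed
  have main: "swap u v \<in> generated"
    if uv: "incomparable u v" and len: "length v \<le> length u" "\<not> length u \<le> 3"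
      and IH: "\<And>u' v' :: bool list. length u' + length v' < length u + length v \<Longrightarrow>
        incomparable u' v' \<Longrightarrow> swap u' v' \<in> generated" for u v :: "bool list"
  proof -
    obtain a b c x where u: "u = [a, b, c] @ x"
      using len(2) by (cases u; cases "tl u"; cases "tl (tl u)") auto
    show ?thesis
    proof (cases "incomparable [a, b, c] v")
      case True
      obtain d w where v: "v = d # w"
        using uv by (cases v) (auto simp: incomparable_def)
      \<comment> \<open>The first letter makes the target disjoint from \<open>v\<close>, the second
        makes it disjoint from \<open>[a, b, c]\<close>. Two letters are needed for this, which is
        why the generating swaps go up to length 3.\<close>
      let ?t = "[\<not> d, \<not> b]"
      have t: "incomparable [a, b, c] ?t" "incomparable ?t v"
        by (auto simp: v incomparable_def)
      show ?thesis
      proof (rule reduce[OF uv t(1)])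
        show "replaces (swap [a, b, c] ?t) u (?t @ x)"
          unfolding u by (rule replaces_append[OF replaces_swap_left])
        show "replaces (swap [a, b, c] ?t) v v"
          using True t by (intro replaces_swap_other) (simp_all add: incomparable_sym)
        show "incomparable (?t @ x) v" by (rule incomparable_append[OF t(2)])
        then show "swap (?t @ x) v \<in> generated" by (intro IH) (simp_all add: u)
      qed simp_all
    next
      case False
      \<comment> \<open>Otherwise \<open>v\<close> would be a prefix of \<open>[a, b, c]\<close> and
        hence of \<open>u\<close>. Both cones now move together, to any word of length 2 with the
        other first letter.\<close>
      then have "\<exists>y. v = [a, b, c] @ y"
        using uv unfolding not_incomparable u
        by (metis append_assoc append_Nil2 incomparable_def)
      then obtain y where v: "v = [a, b, c] @ y" ..
      let ?t = "[\<not> a, True]"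
      have t: "incomparable [a, b, c] ?t" by (simp add: incomparable_def)
      have xy: "incomparable x y" using uv unfolding u v incomparable_append_cancel .
      show ?thesis
      proof (rule reduce[OF uv t])
        show "replaces (swap [a, b, c] ?t) u (?t @ x)" "replaces (swap [a, b, c] ?t) v (?t @ y)"
          unfolding u v by (rule replaces_append[OF replaces_swap_left])+
        show "incomparable (?t @ x) (?t @ y)" using xy unfolding incomparable_append_cancel .
        then show "swap (?t @ x) (?t @ y) \<in> generated" by (intro IH) (simp_all add: u v)
      qed simp_all
    qed
  qed
  consider "length u \<le> 3" "length v \<le> 3" | "length v \<le> length u" "\<not> length u \<le> 3"
    | "length u \<le> length v" "\<not> length v \<le> 3" by linarith
  then show ?case
  proof cases
    case 1
    then show ?thesis using short less.prems by blast
  next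
    case 2
    show ?thesis by (rule main[OF less.prems 2]) (rule less.hyps)
  next
    case 3
    have "swap v u \<in> generated"
      by (rule main[OF _ 3]) (use less in \<open>simp_all add: incomparable_sym[of v u] add.commute\<close>)
    then show ?thesis using swap_commute[OF less.prems] by simp
  qed
qed

section \<open>Complete prefix codes: partitions of the infinite words into cones\<close>

definition complete_code :: "'a list set \<Rightarrow> bool" where
  "complete_code P \<longleftrightarrow> (\<forall>z. \<exists>!p. p \<in> P \<and> z \<in> range ((@-) p))"

lemma complete_code_ex: "complete_code P \<Longrightarrow> \<exists>p\<in>P. \<exists>y. z = p @- y"
  unfolding complete_code_def by blast

lemma complete_code_unique:
  "complete_code P \<Longrightarrow> p \<in> P \<Longrightarrow> q \<in> P \<Longrightarrow> p @- y = q @- z \<Longrightarrow> p = q"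
  unfolding complete_code_def by (metis rangeI)

lemma complete_code_incomparable:
  assumes "complete_code P" "p \<in> P" "q \<in> P" "p \<noteq> q"
  shows "incomparable p q"
proof (rule ccontr)
  assume "\<not> incomparable p q"
  then obtain x y where "p @ x = q @ y" unfolding incomparable_def by blast
  then have "p @- x @- z = q @- y @- z" for z by (metis shift_append)
  then show False using complete_code_unique[OF assms(1-3)] assms(4) by blast
qed

lemma all_shift_Nil:
  assumes "\<And>z :: bool stream. z \<in> range ((@-) p)"
  shows "p = []"
proof (cases p)
  case (Cons a q)
  obtain y where "sconst (\<not> a) = p @- y" using assms by blast
  then have "shd (sconst (\<not> a)) = shd (p @- y)" by simp
  then show ?thesis using Cons by simp
qed

text \<open>Take a longest codeword \<open>c @ [b]\<close>. The codeword that covers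
  \<open>c @ [\<not> b]\<close> cannot be longer, and as a proper prefix it would also be a prefix
  of \<open>c @ [b]\<close>; so the sibling itself is a codeword.\<close>

lemma complete_code_siblings:
  fixes P :: "bool list set"
  assumes P: "complete_code P" and "finite P" "[] \<notin> P"
  obtains c where "\<And>b. c @ [b] \<in> P"
proof -
  have "P \<noteq> {}" using complete_code_ex[OF P] by blast
  then have "Max (length ` P) \<in> length ` P" using \<open>finite P\<close> by simp
  then obtain p where p: "p \<in> P" "length p = Max (length ` P)" by auto
  have max: "length q \<le> length p" if "q \<in> P" for q
    using that p \<open>finite P\<close> by simp
  obtain c b where cb: "p = c @ [b]" using p(1) \<open>[] \<notin> P\<close> by (cases p rule: rev_cases) auto
  obtain q y where q: "q \<in> P" "(c @ [\<not> b]) @- sconst True = q @- y"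
    using complete_code_ex[OF P] by blast
  obtain x where x: "c @ [\<not> b] = q @ x"
    using q(2) by (rule shift_append_cases[OF sym]) (use max[OF q(1)] cb in auto)
  have "x = []"
  proof (rule ccontr)
    assume "x \<noteq> []"
    then have c: "c = q @ butlast x" using x by (metis butlast_append butlast_snoc)
    then have "p @- z = q @- (butlast x @ [b]) @- z" for z using cb by simp
    then have "p = q" using complete_code_unique[OF P p(1) q(1)] by blast
    then show False using c cb by simp
  qed
  then have "c @ [\<not> b] \<in> P" using x q(1) by simp
  then have "c @ [b'] \<in> P" for b' using p(1) cb by (cases "b' = b") auto
  then show ?thesis using that by blast
qed

lemma complete_code_merge:
  fixes P :: "bool list set"
  assumes P: "complete_code P" and c: "\<And>b. c @ [b] \<in> P"
  defines "Q \<equiv> insert c (P - {c @ [True], c @ [False]})"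
  shows "complete_code Q"
  unfolding complete_code_def
proof (intro allI ex_ex1I)
  fix z
  obtain p y where p: "p \<in> P" "z = p @- y" using complete_code_ex[OF P] by blast
  show "\<exists>p. p \<in> Q \<and> z \<in> range ((@-) p)"
  proof (cases "p \<in> Q")
    case False
    then have "p = c @ [True] \<or> p = c @ [False]" using p(1) by (auto simp: Q_def)
    then have "z \<in> range ((@-) c)" using p(2) by auto
    then show ?thesis by (auto simp: Q_def)
  qed (use p in blast)
next
  fix z p q
  assume *: "p \<in> Q \<and> z \<in> range ((@-) p)" "q \<in> Q \<and> z \<in> range ((@-) q)"
  have neq: False if "c @- x = r @- y" "r \<in> P - {c @ [True], c @ [False]}" for x y r
  proof -
    have "(c @ [shd x]) @- stl x = r @- y" using that(1) by (simp add: shift_append)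
    then have "c @ [shd x] = r" using complete_code_unique[OF P c] that(2) by blast
    then show False using that(2) by (cases "shd x") auto
  qed
  obtain x y where xy: "z = p @- x" "z = q @- y" using * by blast
  consider "p = q" | "p \<in> P" "q \<in> P"
    | "p = c" "q \<in> P - {c @ [True], c @ [False]}" | "q = c" "p \<in> P - {c @ [True], c @ [False]}"
    using * by (auto simp: Q_def)
  then show "p = q"
    using neq xy complete_code_unique[OF P] by cases metis+
qed

lemma complete_code_image:
  assumes "complete_code P" "bij f" "\<And>p. p \<in> P \<Longrightarrow> replaces f p (q p)"
  shows "complete_code (q ` P)"
  unfolding complete_code_def
proof (intro allI ex_ex1I)
  fix z
  obtain w where w: "z = f w" using assms(2) by (metis bij_pointE)
  obtain p y where "p \<in> P" "w = p @- y" using complete_code_ex[OF assms(1)] by blast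
  then show "\<exists>p. p \<in> q ` P \<and> z \<in> range ((@-) p)" using assms(3) w by (auto simp: replaces_def)
next
  fix z a b
  assume "a \<in> q ` P \<and> z \<in> range ((@-) a)" "b \<in> q ` P \<and> z \<in> range ((@-) b)"
  then obtain p p' y y' where *: "p \<in> P" "p' \<in> P" "a = q p" "b = q p'" "z = a @- y" "z = b @- y'"
    by blast
  then have "f (p @- y) = f (p' @- y')" using assms(3) by (simp add: replaces_def)
  then have "p @- y = p' @- y'" using assms(2) by (simp add: bij_is_inj inj_eq)
  then show "a = b" using complete_code_unique[OF assms(1)] * by metis
qed

text \<open>The transposition of two codewords, or the identity if they coincide, since
  \<open>swap\<close> is an involution only for incomparable words. Being an involution,
  \<open>s\<close> can be undone later.\<close>

lemma code_permutation:
  assumes Q: "complete_code Q" and ab: "a \<in> Q" "b \<in> Q"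
  shows "\<exists>s\<in>generated. bij s \<and> s \<circ> s = id \<and> replaces s a b \<and>
    (\<forall>c\<in>Q. c \<noteq> a \<longrightarrow> c \<noteq> b \<longrightarrow> replaces s c c) \<and> (\<forall>c\<in>Q. \<exists>d\<in>Q. replaces s c d)"
proof (cases "a = b")
  case True
  then show ?thesis using replaces_id generated_id by (intro bexI[of _ id]) auto
next
  case False
  have inc: "incomparable c d" if "c \<in> Q" "d \<in> Q" "c \<noteq> d" for c d
    using complete_code_incomparable[OF Q that] .
  have ab': "incomparable a b" using inc ab False by blast
  have other: "replaces (swap a b) c c" if "c \<in> Q" "c \<noteq> a" "c \<noteq> b" for c
    using that ab inc by (intro replaces_swap_other) auto
  have "\<exists>d\<in>Q. replaces (swap a b) c d" if "c \<in> Q" for c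
    using that ab other replaces_swap_left replaces_swap_right[OF ab'] by metis
  moreover have "swap a b \<circ> swap a b = id" using swap_swap[OF ab'] by auto
  ultimately show ?thesis
    using swap_generated[OF ab'] bij_swap[OF ab'] other replaces_swap_left by blast
qed

text \<open>
  After a permutation of the image code, two sibling words of the domain code are mapped to
  sibling words, so that the domain code can be made smaller.
\<close>

lemma code_map_generated:
  assumes "finite P" "complete_code P" "bij f" "\<And>p. p \<in> P \<Longrightarrow> \<exists>q. replaces f p q"
  shows "f \<in> generated"
  using assms
proof (induction "card P" arbitrary: P f rule: less_induct)
  case less
  note P = \<open>complete_code P\<close> and f = \<open>bij f\<close>
  obtain q where q: "\<And>p. p \<in> P \<Longrightarrow> replaces f p (q p)" using less.prems(4) by metis
  have Nil: "f = id" if "replaces f [] v" for v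
  proof -
    have f_eq: "f z = v @- z" for z using that by (simp add: replaces_def)
    then have "z \<in> range ((@-) v)" for z using f by (metis bij_pointE rangeI)
    then have "v = []" by (rule all_shift_Nil)
    then show ?thesis using f_eq by auto
  qed
  show ?case
  proof (cases "[] \<in> P")
    case True
    then show ?thesis using q Nil generated_id by metis
  next
    case False
    have Q: "complete_code (q ` P)" by (rule complete_code_image[OF P f q])
    \<comment> \<open>Needed to find siblings in the image code: a cone that is mapped onto
      everything is everything, by injectivity.\<close>
    have "[] \<notin> q ` P"
    proof
      assume "[] \<in> q ` P"
      then obtain p where p: "p \<in> P" "q p = []" by force
      have "z \<in> range ((@-) p)" for z
      proof -
        have "f (p @- f z) = f z" using q[OF p(1)] p(2) by (simp add: replaces_def)
        then have "p @- f z = z" using f by (simp add: bij_is_inj inj_eq)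
        then show ?thesis by (metis rangeI)
      qed
      then have "p = []" by (rule all_shift_Nil)
      then show False using p(1) False by simp
    qed
    then obtain c where c: "\<And>b. c @ [b] \<in> q ` P"
      using complete_code_siblings[OF Q] \<open>finite P\<close> by blast
    obtain d where d: "\<And>b. d @ [b] \<in> P"
      using complete_code_siblings[OF P \<open>finite P\<close> False] by blast
    let ?d0 = "d @ [False]" and ?d1 = "d @ [True]" and ?c0 = "c @ [False]" and ?c1 = "c @ [True]"
    obtain s where s: "s \<in> generated" "bij s" "s \<circ> s = id" "replaces s (q ?d0) ?c0"
      "\<forall>c\<in>q ` P. \<exists>d\<in>q ` P. replaces s c d"
      using code_permutation[OF Q imageI[OF d] c] by blast
    obtain e where e: "e \<in> q ` P" "replaces s (q ?d1) e" using s(5) d by blast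
    \<comment> \<open>Injectivity separates the images of the two sibling cones. Consequently
      \<open>t\<close>, which moves \<open>e\<close> to \<open>?c1\<close>, leaves
      \<open>?c0\<close> in place.\<close>
    have "e \<noteq> ?c0"
    proof
      assume "e = ?c0"
      then have "replaces (Hilbert_Choice.inv s) ?c0 (q ?d1)" "replaces (Hilbert_Choice.inv s) ?c0 (q ?d0)"
        using e(2) s(2,4) by (simp_all add: replaces_inv)
      then have "q ?d1 = q ?d0" by (rule replaces_unique)
      then have "replaces f ?d1 (q ?d0)" "replaces f ?d0 (q ?d0)"
        using q[OF d[of True]] q[OF d[of False]] by simp_all
      then have "replaces (Hilbert_Choice.inv f) (q ?d0) ?d1" "replaces (Hilbert_Choice.inv f) (q ?d0) ?d0"
        using f by (simp_all add: replaces_inv)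
      then have "?d1 = ?d0" by (rule replaces_unique)
      then show False by simp
    qed
    obtain t where t: "t \<in> generated" "bij t" "t \<circ> t = id" "replaces t e ?c1"
      "\<forall>c\<in>q ` P. c \<noteq> e \<longrightarrow> c \<noteq> ?c1 \<longrightarrow> replaces t c c"
      "\<forall>c\<in>q ` P. \<exists>d\<in>q ` P. replaces t c d"
      using code_permutation[OF Q e(1) c] by blast
    \<comment> \<open>Now the two halves of the cone of \<open>d\<close> go in order to the two
      halves of the cone of \<open>c\<close>, so \<open>g\<close> replaces \<open>d\<close> by
      \<open>c\<close> and the two codewords below \<open>d\<close> merge into one.\<close>
    define g where "g = t \<circ> (s \<circ> f)"
    have g0: "replaces g ?d0 ?c0"
      unfolding g_def using \<open>e \<noteq> ?c0\<close> c by (intro replaces_comp[OF replaces_comp[OF q[OF d] s(4)]] t(5)[rule_format]) auto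
    have g1: "replaces g ?d1 ?c1"
      unfolding g_def by (rule replaces_comp[OF replaces_comp[OF q[OF d] e(2)] t(4)])
    have gd: "replaces g d c"
      unfolding replaces_def
    proof
      fix z
      show "g (d @- z) = c @- z"
        using g0 g1 by (cases z; cases "shd z") (auto simp: replaces_def)
    qed
    let ?P = "insert d (P - {?d1, ?d0})"
    have "g \<in> generated"
    proof (rule less.hyps[of ?P])
      have "card ?P \<le> Suc (card (P - {?d1, ?d0}))" by (simp add: card_insert_le_m1 card_insert_if \<open>finite P\<close>)
      also have "card (P - {?d1, ?d0}) = card P - 2"
        using d by (subst card_Diff_subset) auto
      also have "Suc (card P - 2) < card P"
        using card_mono[OF \<open>finite P\<close>, of "{?d1, ?d0}"] d by simp
      finally show "card ?P < card P" .
      show "complete_code ?P" by (rule complete_code_merge[OF P d])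
      show "bij g" unfolding g_def using s t f by (intro bij_comp)
      show "\<exists>r. replaces g p r" if "p \<in> ?P" for p
      proof (cases "p = d")
        case True
        then show ?thesis using gd by blast
      next
        case False
        then have "p \<in> P" using that by blast
        moreover obtain r where "r \<in> q ` P" "replaces s (q p) r" using s(5) \<open>p \<in> P\<close> by blast
        moreover obtain r' where "replaces t r r'" using t(6) \<open>r \<in> q ` P\<close> by blast
        ultimately show ?thesis unfolding g_def using q replaces_comp by blast
      qed
    qed (use \<open>finite P\<close> in simp)
    then have "s \<circ> (t \<circ> g) \<in> generated" using s(1) t(1) generated_comp by blast
    moreover have "s \<circ> (t \<circ> g) = f"
      unfolding g_def using s(3) t(3) by (simp add: fun_eq_iff)
    ultimately show ?thesis by simp
  qed
qed

lemma complete_code_words: "complete_code {u. length u = n}"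
  unfolding complete_code_def
proof
  fix z :: "'a stream"
  have "stake n z \<in> {u. length u = n} \<and> z \<in> range ((@-) (stake n z))"
    by (simp, metis stake_sdrop rangeI)
  moreover have "p = stake n z" if "p \<in> {u. length u = n} \<and> z \<in> range ((@-) p)" for p
    using that by (auto simp: stake_shift)
  ultimately show "\<exists>!p. p \<in> {u. length u = n} \<and> z \<in> range ((@-) p)" by (rule ex1I)
qed

lemma finite_generating_set_cantor_V:
  "finite_generating_set cantor_V (carrier cantor_V) short_swaps"
proof -
  have "f \<in> generated" if f: "f \<in> carrier cantor_V" for f
  proof -
    obtain n where n: "\<And>u. n \<le> length u \<Longrightarrow> \<exists>v. replaces f u v" using cantor_VE[OF f] by blast
    show ?thesis
      by (rule code_map_generated[OF finite_words[of n] complete_code_words cantor_V_bij[OF f]])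
        (use n in auto)
  qed
  then show ?thesis
    using cantor_V.generate_incl[OF short_swaps_subset] finite_short_swaps short_swaps_subset
    by (auto simp: finite_generating_set_def)
qed

section \<open>Word length and distortion\<close>

lemma word_length_le:
  "set ws \<subseteq> B \<union> m_inv G ` B \<Longrightarrow> foldr (\<otimes>\<^bsub>G\<^esub>) ws \<one>\<^bsub>G\<^esub> = g \<Longrightarrow> word_length G B g \<le> length ws"
  unfolding word_length_def by (rule Least_le) blast

context group
begin

lemma foldr_mult_closed: "set ws \<subseteq> carrier G \<Longrightarrow> foldr (\<otimes>) ws \<one> \<in> carrier G"
  by (induction ws) auto

lemma foldr_mult_append:
  "set us \<subseteq> carrier G \<Longrightarrow> set ws \<subseteq> carrier G \<Longrightarrow>
    foldr (\<otimes>) (us @ ws) \<one> = foldr (\<otimes>) us \<one> \<otimes> foldr (\<otimes>) ws \<one>"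
  by (induction us) (auto simp: m_assoc foldr_mult_closed simp del: foldr_append)

lemma generators_closed: "B \<subseteq> carrier G \<Longrightarrow> B \<union> m_inv G ` B \<subseteq> carrier G"
  by auto

lemma generate_iff_word:
  assumes B: "B \<subseteq> carrier G"
  shows "g \<in> generate G B \<longleftrightarrow> (\<exists>ws. set ws \<subseteq> B \<union> m_inv G ` B \<and> foldr (\<otimes>) ws \<one> = g)"
proof
  assume "g \<in> generate G B"
  then show "\<exists>ws. set ws \<subseteq> B \<union> m_inv G ` B \<and> foldr (\<otimes>) ws \<one> = g"
  proof (induction rule: generate.induct)
    case one
    show ?case by (rule exI[of _ "[]"]) simp
  next
    case (incl h)
    then show ?case using B by (intro exI[of _ "[h]"]) auto
  next
    case (inv h)
    then show ?case using B by (intro exI[of _ "[inv h]"]) auto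
  next
    case (eng h1 h2)
    then obtain us ws where
      "set us \<subseteq> B \<union> m_inv G ` B" "foldr (\<otimes>) us \<one> = h1"
      "set ws \<subseteq> B \<union> m_inv G ` B" "foldr (\<otimes>) ws \<one> = h2" by blast
    then have "set (us @ ws) \<subseteq> B \<union> m_inv G ` B" "foldr (\<otimes>) (us @ ws) \<one> = h1 \<otimes> h2"
      using generators_closed[OF B] foldr_mult_append[of us ws] by auto
    then show ?case by blast
  qed
next
  assume "\<exists>ws. set ws \<subseteq> B \<union> m_inv G ` B \<and> foldr (\<otimes>) ws \<one> = g"
  then obtain ws where ws: "set ws \<subseteq> B \<union> m_inv G ` B" "foldr (\<otimes>) ws \<one> = g" by blast
  have "foldr (\<otimes>) ws \<one> \<in> generate G B"
    using ws(1) by (induction ws) (auto intro: generate.intros)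
  then show "g \<in> generate G B" using ws(2) by simp
qed

lemma word_length_attained:
  assumes "B \<subseteq> carrier G" "g \<in> generate G B"
  obtains ws where "length ws = word_length G B g" "set ws \<subseteq> B \<union> m_inv G ` B"
    "foldr (\<otimes>) ws \<one> = g"
proof -
  have "\<exists>n ws. length ws = n \<and> set ws \<subseteq> B \<union> m_inv G ` B \<and> foldr (\<otimes>) ws \<one> = g"
    using assms generate_iff_word by blast
  then have "\<exists>ws. length ws = word_length G B g \<and> set ws \<subseteq> B \<union> m_inv G ` B \<and> foldr (\<otimes>) ws \<one> = g"
    unfolding word_length_def by (rule LeastI_ex)
  then show ?thesis using that by blast
qed

text \<open>The words use no formal inverses because the sets \<open>X\<close> of the applications
  are closed under inversion.\<close>

lemma linear_distortionI:
  assumes B: "finite_generating_set G (carrier G) B"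
    and H: "subgroup H G" and X: "finite X" "X \<subseteq> H" and C: "C > 0"
    and words: "\<And>g. g \<in> H \<Longrightarrow> \<exists>ws. set ws \<subseteq> X \<and> foldr (\<otimes>) ws \<one> = g \<and>
      length ws \<le> C * word_length G B g"
  shows "linear_distortion G H"
proof -
  have XG: "X \<subseteq> carrier G" using X(2) subgroup.subset[OF H] by blast
  have "generate G X = H"
  proof
    show "generate G X \<subseteq> H" by (rule generate_subgroup_incl[OF X(2) H])
    show "H \<subseteq> generate G X" using words generate_iff_word[OF XG] by fast
  qed
  then have gen: "finite_generating_set G H X" using X by (simp add: finite_generating_set_def)
  have bound: "real (word_length G X g) \<le> real C * real (word_length G B g)" if g: "g \<in> H" for g
  proof -
    obtain ws where ws: "set ws \<subseteq> X" "foldr (\<otimes>) ws \<one> = g" "length ws \<le> C * word_length G B g"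
      using words[OF g] by blast
    then have "word_length G X g \<le> length ws" by (intro word_length_le) auto
    then have "word_length G X g \<le> C * word_length G B g" using ws(3) by linarith
    then show ?thesis by (metis of_nat_le_iff of_nat_mult)
  qed
  show ?thesis
    unfolding linear_distortion_def using B gen
    by (intro exI[of _ B] exI[of _ X] conjI exI[of _ "real C"] ballI bound) (use C in auto)
qed

end

context group_hom
begin

lemma hom_foldr_mult:
  "set ws \<subseteq> carrier G \<Longrightarrow>
    foldr (\<otimes>\<^bsub>H\<^esub>) (map h ws) \<one>\<^bsub>H\<^esub> = h (foldr (\<otimes>\<^bsub>G\<^esub>) ws \<one>\<^bsub>G\<^esub>)"
  by (induction ws) (auto simp: G.foldr_mult_closed)

lemma word_length_image:
  assumes inj: "inj_on h (carrier G)" and B: "B \<subseteq> carrier G" and g: "g \<in> carrier G"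
  shows "word_length H (h ` B) (h g) = word_length G B g"
proof -
  let ?S = "B \<union> m_inv G ` B"
  have S: "?S \<subseteq> carrier G" by (rule G.generators_closed[OF B])
  have image: "h ` B \<union> m_inv H ` (h ` B) = h ` ?S"
  proof -
    have "m_inv H ` (h ` B) = h ` (m_inv G ` B)"
      unfolding image_image using B by (intro image_cong refl) auto
    then show ?thesis by (simp add: image_Un)
  qed
  have "(\<exists>ws. length ws = n \<and> set ws \<subseteq> h ` ?S \<and> foldr (\<otimes>\<^bsub>H\<^esub>) ws \<one>\<^bsub>H\<^esub> = h g) \<longleftrightarrow>
      (\<exists>ws. length ws = n \<and> set ws \<subseteq> ?S \<and> foldr (\<otimes>\<^bsub>G\<^esub>) ws \<one>\<^bsub>G\<^esub> = g)" for n
  proof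
    assume "\<exists>ws. length ws = n \<and> set ws \<subseteq> h ` ?S \<and> foldr (\<otimes>\<^bsub>H\<^esub>) ws \<one>\<^bsub>H\<^esub> = h g"
    then obtain ws where ws: "length ws = n" "ws \<in> lists (h ` ?S)"
      "foldr (\<otimes>\<^bsub>H\<^esub>) ws \<one>\<^bsub>H\<^esub> = h g" by auto
    then obtain us where us: "set us \<subseteq> ?S" "ws = map h us" unfolding lists_image by auto
    have usG: "set us \<subseteq> carrier G" using us(1) S by (rule subset_trans)
    have "h (foldr (\<otimes>\<^bsub>G\<^esub>) us \<one>\<^bsub>G\<^esub>) = h g"
      using ws(3) us(2) hom_foldr_mult[OF usG] by simp
    then have "foldr (\<otimes>\<^bsub>G\<^esub>) us \<one>\<^bsub>G\<^esub> = g"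
      using inj_onD[OF inj] g G.foldr_mult_closed[OF usG] by blast
    then show "\<exists>ws. length ws = n \<and> set ws \<subseteq> ?S \<and> foldr (\<otimes>\<^bsub>G\<^esub>) ws \<one>\<^bsub>G\<^esub> = g"
      using us ws(1) by (intro exI[of _ us]) simp
  next
    assume "\<exists>ws. length ws = n \<and> set ws \<subseteq> ?S \<and> foldr (\<otimes>\<^bsub>G\<^esub>) ws \<one>\<^bsub>G\<^esub> = g"
    then obtain ws where ws: "length ws = n" "set ws \<subseteq> ?S" "foldr (\<otimes>\<^bsub>G\<^esub>) ws \<one>\<^bsub>G\<^esub> = g" by blast
    then have "foldr (\<otimes>\<^bsub>H\<^esub>) (map h ws) \<one>\<^bsub>H\<^esub> = h g"
      using hom_foldr_mult[OF subset_trans[OF ws(2) S]] by simp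
    then show "\<exists>ws. length ws = n \<and> set ws \<subseteq> h ` ?S \<and> foldr (\<otimes>\<^bsub>H\<^esub>) ws \<one>\<^bsub>H\<^esub> = h g"
      using ws(1,2) by (intro exI[of _ "map h ws"]) auto
  qed
  then show ?thesis unfolding word_length_def image by simp
qed

text \<open>All estimates are made in \<open>cantor_V\<close>; this transfers them to
  \<open>thompson_V\<close> with the same constant, because an injective homomorphism preserves word
  lengths.\<close>

lemma linear_distortion_image:
  assumes h: "bij_betw h (carrier G) (carrier H)"
    and K: "K \<subseteq> carrier G" "linear_distortion G K"
  shows "linear_distortion H (h ` K)"
proof -
  have inj: "inj_on h (carrier G)" using h by (rule bij_betw_imp_inj_on)
  obtain B X C where B: "finite_generating_set G (carrier G) B"
    and X: "finite_generating_set G K X" and C: "C > 0"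
    "\<forall>g\<in>K. real (word_length G X g) \<le> C * real (word_length G B g)"
    using K(2) unfolding linear_distortion_def by blast
  have BG: "B \<subseteq> carrier G" and XG: "X \<subseteq> carrier G"
    using B X K(1) by (auto simp: finite_generating_set_def)
  have "finite_generating_set H (carrier H) (h ` B)" "finite_generating_set H (h ` K) (h ` X)"
    using B X bij_betw_imp_surj_on[OF h] generate_img[OF BG] generate_img[OF XG]
    by (auto simp: finite_generating_set_def)
  moreover have "\<forall>g\<in>h ` K. real (word_length H (h ` X) g) \<le> C * real (word_length H (h ` B) g)"
    using C(2) K(1) word_length_image[OF inj BG] word_length_image[OF inj XG] by auto
  ultimately show ?thesis using C(1) unfolding linear_distortion_def by blast
qed

end

section \<open>Growth of prefixes\<close>

text \<open>The number \<open>length v - length u\<close> does not change when \<open>u\<close> and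
  \<open>v\<close> are prolonged by the same word. It is the local contraction exponent of
  \<open>f\<close> on the Cantor set, and its chain rule yields subadditivity.\<close>

definition grows_by :: "(bool stream \<Rightarrow> bool stream) \<Rightarrow> nat \<Rightarrow> bool" where
  "grows_by f k \<longleftrightarrow> (\<forall>u v. replaces f u v \<longrightarrow> length v \<le> length u + k)"

lemma grows_by_id: "grows_by id k"
  unfolding grows_by_def using replaces_unique[OF replaces_id] by fastforce

text \<open>The composite may replace a word \<open>u\<close> that \<open>g\<close> alone does not
  replace. Padding by \<open>n\<close> letters makes an intermediate word available and cancels in
  the final inequality.\<close>

lemma grows_by_comp:
  assumes "grows_by f k" "grows_by g l" and g: "g \<in> carrier cantor_V"
  shows "grows_by (f \<circ> g) (k + l)"
  unfolding grows_by_def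
proof (intro allI impI)
  fix u v assume uv: "replaces (f \<circ> g) u v"
  obtain n where n: "\<And>u. n \<le> length u \<Longrightarrow> \<exists>v. replaces g u v" using cantor_VE[OF g] by blast
  let ?x = "replicate n True"
  obtain w where w: "replaces g (u @ ?x) w" using n[of "u @ ?x"] by auto
  have "replaces f w (v @ ?x)"
    unfolding replaces_def
  proof
    fix z
    have "f (g ((u @ ?x) @- z)) = (v @ ?x) @- z"
      using replaces_append[OF uv, of ?x] unfolding replaces_def o_def by blast
    then show "f (w @- z) = (v @ ?x) @- z" using w unfolding replaces_def by simp
  qed
  then have "length (v @ ?x) \<le> length w + k" "length w \<le> length (u @ ?x) + l"
    using assms(1,2) w unfolding grows_by_def by blast+
  then show "length v \<le> length u + (k + l)" by simp
qed

lemma grows_by_mono: "grows_by f k \<Longrightarrow> k \<le> l \<Longrightarrow> grows_by f l"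
  unfolding grows_by_def by fastforce

text \<open>Padding \<open>u\<close> by \<open>n\<close> letters and comparing its two replacements
  gives \<open>length v + n = length w + length u\<close>, where \<open>w\<close> is the image of a
  word of length \<open>n\<close> and thus bounded by \<open>m\<close>.\<close>

lemma ex_grows_by:
  assumes f: "f \<in> carrier cantor_V"
  shows "\<exists>k. grows_by f k"
proof -
  obtain n where n: "\<And>u. n \<le> length u \<Longrightarrow> \<exists>v. replaces f u v" using cantor_VE[OF f] by blast
  then obtain m where m: "\<And>u. length u = n \<Longrightarrow> \<exists>v. replaces f u v \<and> length v \<le> m"
    using bounded_replacement[of n f] by auto
  have "length v \<le> length u + m" if uv: "replaces f u v" for u v
  proof -
    define x where "x = u @ replicate n True"
    have "length (take n x) = n" by (simp add: x_def)
    then obtain w where w: "replaces f (take n x) w" "length w \<le> m" using m by blast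
    have "replaces f x (w @ drop n x)"
      using replaces_append[OF w(1), of "drop n x"] by simp
    moreover have "replaces f x (v @ replicate n True)"
      unfolding x_def by (rule replaces_append[OF uv])
    ultimately have "w @ drop n x = v @ replicate n True" by (rule replaces_unique)
    then have "length (w @ drop n x) = length (v @ replicate n True)" by simp
    then show ?thesis using w(2) by (simp add: x_def)
  qed
  then show ?thesis unfolding grows_by_def by blast
qed

lemma grows_by_word_length:
  assumes B: "finite_generating_set cantor_V (carrier cantor_V) B"
  obtains k where "k > 0"
    "\<And>g. g \<in> carrier cantor_V \<Longrightarrow> grows_by g (k * word_length cantor_V B g)"
proof -
  let ?S = "B \<union> m_inv cantor_V ` B"
  have BG: "B \<subseteq> carrier cantor_V" and fin: "finite ?S"
    and gen: "generate cantor_V B = carrier cantor_V"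
    using B by (auto simp: finite_generating_set_def)
  have S: "?S \<subseteq> carrier cantor_V" by (rule cantor_V.generators_closed[OF BG])
  obtain K where K: "\<And>s. s \<in> ?S \<Longrightarrow> grows_by s (K s)" using ex_grows_by S by (metis subsetD)
  \<comment> \<open>The sum bounds the growth of each of the finitely many generators and inverses;
    \<open>Suc\<close> makes the constant positive.\<close>
  define k where "k = Suc (\<Sum>s\<in>?S. K s)"
  have k: "grows_by s k" if "s \<in> ?S" for s
  proof (rule grows_by_mono[OF K[OF that]])
    have "K s \<le> (\<Sum>s\<in>?S. K s)" by (rule member_le_sum[OF that _ fin]) simp
    then show "K s \<le> k" by (simp add: k_def)
  qed
  have word: "grows_by (foldr (\<circ>) ws id) (k * length ws)" if "set ws \<subseteq> ?S" for ws
    using that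
  proof (induction ws)
    case Nil
    show ?case using grows_by_id by (simp add: id_def)
  next
    case (Cons s ws)
    have "set ws \<subseteq> carrier cantor_V" using Cons.prems S by auto
    then have "foldr (\<circ>) ws id \<in> carrier cantor_V"
      using cantor_V.foldr_mult_closed[of ws] by simp
    moreover have "grows_by (foldr (\<circ>) ws id) (k * length ws)"
      by (rule Cons.IH) (use Cons.prems in simp)
    ultimately have "grows_by (s \<circ> foldr (\<circ>) ws id) (k + k * length ws)"
      using k Cons.prems by (intro grows_by_comp) simp_all
    moreover have "foldr (\<circ>) (s # ws) id = s \<circ> foldr (\<circ>) ws id" by simp
    ultimately show ?case by (simp only: length_Cons mult_Suc_right)
  qed
  have "grows_by g (k * word_length cantor_V B g)" if g: "g \<in> carrier cantor_V" for g
  proof -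
    obtain ws where ws: "length ws = word_length cantor_V B g" "set ws \<subseteq> ?S"
      "foldr (\<otimes>\<^bsub>cantor_V\<^esub>) ws \<one>\<^bsub>cantor_V\<^esub> = g"
      using cantor_V.word_length_attained[OF BG, of g] gen g by auto
    then show ?thesis using word[OF ws(2)] by simp
  qed
  then show ?thesis using that[of k] by (simp add: k_def)
qed

text \<open>
  Growth is a lower bound for the word length in \<open>V\<close>, so an embedding is undistorted as soon as
  the growth of an image is at least proportional to the length of a word for it.
\<close>

lemma undistorted_embedding:
  fixes F :: "('a, 'm) monoid_scheme" and h :: "'a \<Rightarrow> bool stream \<Rightarrow> bool stream"
  assumes F: "carrier F \<noteq> {}" "\<And>x y. x \<in> carrier F \<Longrightarrow> y \<in> carrier F \<Longrightarrow> x \<otimes>\<^bsub>F\<^esub> y \<in> carrier F"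
    and h: "h \<in> hom F cantor_V" "inj_on h (carrier F)"
    and inverse: "\<And>x. x \<in> carrier F \<Longrightarrow> \<exists>y\<in>carrier F. h y \<circ> h x = id"
    and X: "finite X" "X \<subseteq> h ` carrier F" and C: "C > 0"
    and words: "\<And>x. x \<in> carrier F \<Longrightarrow> \<exists>ws. set ws \<subseteq> X \<and> foldr (\<circ>) ws id = h x \<and>
      (\<forall>k. grows_by (h x) k \<longrightarrow> length ws \<le> C * k)"
  shows "\<exists>H. subgroup H thompson_V \<and> (thompson_V\<lparr>carrier := H\<rparr>) \<cong> F \<and> linear_distortion thompson_V H"
proof -
  let ?K = "h ` carrier F" and ?H = "(germ \<circ> h) ` carrier F"
  have K: "?K \<subseteq> carrier cantor_V" using h(1) by (auto simp: hom_def)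
  have hom: "h (x \<otimes>\<^bsub>F\<^esub> y) = h x \<circ> h y" if "x \<in> carrier F" "y \<in> carrier F" for x y
    using hom_mult[OF h(1) that] by simp
  have subgroup: "subgroup ?K cantor_V"
  proof (rule cantor_V.subgroupI[OF K])
    show "?K \<noteq> {}" using F(1) by simp
    fix f assume "f \<in> ?K"
    then obtain x where x: "x \<in> carrier F" "f = h x" by blast
    then obtain y where y: "y \<in> carrier F" "h y \<circ> h x = id" using inverse by blast
    then have "inv\<^bsub>cantor_V\<^esub> f = h y"
      using x K by (intro cantor_V.inv_equality) auto
    then show "inv\<^bsub>cantor_V\<^esub> f \<in> ?K" using y(1) by simp
  next
    fix f g assume "f \<in> ?K" "g \<in> ?K"
    then obtain x y where "x \<in> carrier F" "y \<in> carrier F" "f = h x" "g = h y" by blast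
    then show "f \<otimes>\<^bsub>cantor_V\<^esub> g \<in> ?K" using hom[of x y] F(2)[of x y] by (metis image_eqI mult_cantor_V)
  qed
  interpret germ: group_hom cantor_V thompson_V germ
    using group_cantor_V group_thompson_V germ_iso
    by (simp add: group_hom_def group_hom_axioms_def iso_def)
  have H: "?H = germ ` ?K" by (simp add: image_comp)
  have "linear_distortion cantor_V ?K"
  proof -
    obtain k where k: "k > 0"
      "\<And>g. g \<in> carrier cantor_V \<Longrightarrow> grows_by g (k * word_length cantor_V short_swaps g)"
      using grows_by_word_length[OF finite_generating_set_cantor_V] by blast
    show ?thesis
    proof (rule cantor_V.linear_distortionI[OF finite_generating_set_cantor_V subgroup X])
      show "C * k > 0" using C k(1) by simp
      fix g assume "g \<in> ?K"
      then obtain x where x: "x \<in> carrier F" "g = h x" by blast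
      then obtain ws where ws: "set ws \<subseteq> X" "foldr (\<circ>) ws id = g"
        "\<forall>k. grows_by g k \<longrightarrow> length ws \<le> C * k" using words by blast
      \<comment> \<open>The constants multiply: \<open>C\<close> compares the length of
        \<open>ws\<close> with growth, and \<open>k\<close> compares growth with the word length in
        \<open>cantor_V\<close>.\<close>
      have "length ws \<le> C * (k * word_length cantor_V short_swaps g)"
        using ws(3) k(2) x K by blast
      then show "\<exists>ws. set ws \<subseteq> X \<and> foldr (\<otimes>\<^bsub>cantor_V\<^esub>) ws \<one>\<^bsub>cantor_V\<^esub> = g \<and>
          length ws \<le> C * k * word_length cantor_V short_swaps g"
        using ws(1,2) by (intro exI[of _ ws]) (simp add: mult.assoc)
    qed
  qed
  then have "linear_distortion thompson_V ?H"
    unfolding H using germ_iso K by (intro germ.linear_distortion_image) (simp_all add: iso_def)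
  moreover have "subgroup ?H thompson_V"
    unfolding H by (rule germ.subgroup_img_is_subgroup[OF subgroup])
  \<comment> \<open>The isomorphism has to lead from the subgroup to \<open>F\<close>, hence the
    inverse of the embedding.\<close>
  moreover have "inv_into (carrier F) (germ \<circ> h) \<in> iso (thompson_V\<lparr>carrier := ?H\<rparr>) F"
  proof -
    have inj: "inj_on (germ \<circ> h) (carrier F)"
      using h(2) inj_on_germ K by (intro comp_inj_on) (auto intro: inj_on_subset)
    have "bij_betw (inv_into (carrier F) (germ \<circ> h)) ?H (carrier F)"
      using inj by (intro bij_betw_inv_into) (simp add: bij_betw_def)
    moreover have "inv_into (carrier F) (germ \<circ> h) (a \<otimes>\<^bsub>thompson_V\<^esub> b) =
        inv_into (carrier F) (germ \<circ> h) a \<otimes>\<^bsub>F\<^esub> inv_into (carrier F) (germ \<circ> h) b"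
      if ab: "a \<in> ?H" "b \<in> ?H" for a b
    proof -
      obtain x y where xy: "x \<in> carrier F" "y \<in> carrier F" "a = (germ \<circ> h) x" "b = (germ \<circ> h) y"
        using ab by blast
      have "a \<otimes>\<^bsub>thompson_V\<^esub> b = (germ \<circ> h) (x \<otimes>\<^bsub>F\<^esub> y)"
        using xy K hom[of x y] by (simp add: germ_comp image_subset_iff)
      then show ?thesis using inv_into_f_f[OF inj] xy F(2)[of x y] by metis
    qed
    ultimately show ?thesis
      unfolding iso_def hom_def using bij_betw_imp_funcset by force
  qed
  ultimately show ?thesis using is_isoI by blast
qed

section \<open>A free group by ping-pong\<close>

lemma reduced_Nil: "reduced []"
  by (simp add: reduced_def)

lemma reduced_single: "reduced [l]"
  by (auto simp: reduced_def append_eq_Cons_conv)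

text \<open>A forbidden factor stands either at the front, where \<open>u\<close> is empty, or
  inside the tail. This recursive form of \<open>reduced\<close> is the one suited to
  induction.\<close>

lemma reduced_Cons_Cons:
  "reduced (l # m # w) \<longleftrightarrow> m \<noteq> (fst l, \<not> snd l) \<and> reduced (m # w)"
  unfolding reduced_def
proof (intro iffI conjI notI)
  assume *: "\<nexists>u x e v. l # m # w = u @ [(x, e), (x, \<not> e)] @ v"
  show False if "m = (fst l, \<not> snd l)"
    using * that by (metis append_Cons append_Nil prod.collapse)
  show False if "\<exists>u x e v. m # w = u @ [(x, e), (x, \<not> e)] @ v"
    using * that by (metis append_Cons)
next
  assume *: "m \<noteq> (fst l, \<not> snd l) \<and> (\<nexists>u x e v. m # w = u @ [(x, e), (x, \<not> e)] @ v)"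
  assume "\<exists>u x e v. l # m # w = u @ [(x, e), (x, \<not> e)] @ v"
  then obtain u x e v where eq: "l # m # w = u @ [(x, e), (x, \<not> e)] @ v" by blast
  show False
  proof (cases u)
    case Nil
    then show ?thesis using eq * by auto
  next
    case (Cons a u')
    then show ?thesis using eq * by auto
  qed
qed

lemma reduced_tl: "reduced (l # w) \<Longrightarrow> reduced w"
  by (cases w) (simp_all add: reduced_Nil reduced_Cons_Cons)

lemma reduced_cons_reduce: "reduced w \<Longrightarrow> reduced (cons_reduce l w)"
  by (cases w) (auto simp: reduced_single reduced_Cons_Cons intro: reduced_tl)

lemma reduced_foldr_cons_reduce: "reduced v \<Longrightarrow> reduced (foldr cons_reduce u v)"
  by (induction u) (auto intro: reduced_cons_reduce)

lemma carrier_FG2: "carrier FG2 = {w. reduced w}"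
  and mult_FG2: "u \<otimes>\<^bsub>FG2\<^esub> v = foldr cons_reduce u v"
  by (simp_all add: FG2_def free_group_def)

text \<open>
  The letter \<open>(x, e)\<close> maps the cone \<open>[x, e]\<close> to \<open>[x, e, False]\<close>, the cone \<open>[\<not> x]\<close> to \<open>[x, e, True]\<close>, and
  the cone \<open>[x, \<not> e]\<close> onto the remaining cones by the inverse of \<open>(x, \<not> e)\<close>. So it maps everything
  outside the cone of its inverse into its own cone, and there it makes prefixes longer.
\<close>

fun letter :: "bool \<times> bool \<Rightarrow> bool stream \<Rightarrow> bool stream" where
  "letter (x, e) z =
     (if shd z \<noteq> x then [x, e, True] @- stl z
      else if shd (stl z) = e then [x, e, False] @- stl (stl z)
      else if shd (stl (stl z)) then (\<not> x) ## stl (stl (stl z))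
      else [x, \<not> e] @- stl (stl (stl z)))"

definition rho :: "(bool \<times> bool) list \<Rightarrow> bool stream \<Rightarrow> bool stream" where
  "rho w = foldr (\<circ>) (map letter w) id"

lemma rho_Nil [simp]: "rho [] = id"
  and rho_Cons [simp]: "rho (l # w) = letter l \<circ> rho w"
  by (simp_all add: rho_def)

lemma letter_inverse: "letter (x, \<not> e) (letter (x, e) z) = z"
proof -
  obtain a b c y where "z = a ## b ## c ## y" by (metis stream.collapse)
  then show ?thesis by (cases a; cases b; cases c; cases x; cases e) simp_all
qed

lemma letter_comp_inverse:
  "letter (fst l, \<not> snd l) \<circ> letter l = id" "letter l \<circ> letter (fst l, \<not> snd l) = id"
  using letter_inverse[of "fst l" "snd l"] letter_inverse[of "fst l" "\<not> snd l"]
  by (auto simp: fun_eq_iff simp del: letter.simps)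

lemma letter_in_cantor_V: "letter l \<in> carrier cantor_V"
proof (rule cantor_VI)
  show "bij (letter l)" by (rule o_bij[OF letter_comp_inverse])
  fix u :: "bool list" assume "length u = 3"
  then obtain a b c where u: "u = [a, b, c]" by (auto simp: numeral_3_eq_3 length_Suc_conv)
  obtain x e where l: "l = (x, e)" by fastforce
  show "\<exists>v. replaces (letter l) u v"
  proof (intro exI)
    show "replaces (letter l) u
        (if a \<noteq> x then [x, e, True, b, c] else if b = e then [x, e, False, c]
         else if c then [\<not> x] else [x, \<not> e])"
      by (simp add: replaces_def u l)
  qed
qed

lemma rho_in_cantor_V: "rho w \<in> carrier cantor_V"
  by (induction w)
    (simp_all only: rho_Nil rho_Cons id_in_cantor_V comp_in_cantor_V letter_in_cantor_V)

text \<open>Cancelling a letter against its formal inverse does not change the composed map. Hence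
  \<open>rho\<close> is multiplicative without appeal to a universal property.\<close>

lemma rho_cons_reduce: "rho (cons_reduce l w) = letter l \<circ> rho w"
proof (cases w)
  case (Cons m v)
  show ?thesis
  proof (cases "m = (fst l, \<not> snd l)")
    case True
    then have "letter l \<circ> rho w = (letter l \<circ> letter (fst l, \<not> snd l)) \<circ> rho v"
      using Cons by (simp add: o_assoc)
    then show ?thesis using Cons True letter_comp_inverse(2) by simp
  qed (use Cons in simp)
qed simp

lemma rho_mult: "rho (foldr cons_reduce u v) = rho u \<circ> rho v"
  by (induction u) (simp_all add: rho_cons_reduce o_assoc)

text \<open>The last letter \<open>(x, e)\<close> acts first and takes \<open>[\<not> x]\<close> to
  \<open>[x, e, True]\<close>. Afterwards the prefix lies in the cone of the letter just applied, so
  the conclusion names the cone of \<open>hd w\<close>: this is what the next letter has to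
  know.\<close>

lemma rho_prefix:
  assumes "reduced w" "w \<noteq> []"
  shows "\<exists>v. replaces (rho w) [\<not> fst (last w)] (fst (hd w) # snd (hd w) # v) \<and> length w \<le> length v"
  using assms
proof (induction w)
  case (Cons l w)
  obtain x e where l: "l = (x, e)" by fastforce
  show ?case
  proof (cases w)
    case Nil
    then show ?thesis by (intro exI[of _ "[True]"]) (simp add: l replaces_def)
  next
    case w: (Cons m w')
    obtain y d where m: "m = (y, d)" by fastforce
    have red: "reduced w" "m \<noteq> (x, \<not> e)"
      using Cons.prems(1) by (auto simp: w l reduced_Cons_Cons)
    have ends: "w \<noteq> []" "hd w = (y, d)" "last (l # w) = last w" by (simp_all add: w m)
    obtain v where v: "replaces (rho w) [\<not> fst (last w)] (y # d # v)" "length w \<le> length v"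
      using Cons.IH[OF red(1)] ends by auto
    \<comment> \<open>Reducedness excludes the cone of the inverse letter, so only lengthening
      branches remain: one letter more for the same generator, two more for the other
      generator.\<close>
    have "replaces (letter l) (y # d # v) (x # e # (if y = x then False # v else True # d # v))"
      using red(2) by (auto simp: replaces_def l m)
    then have "replaces (rho (l # w)) [\<not> fst (last w)]
        (x # e # (if y = x then False # v else True # d # v))"
      unfolding rho_Cons by (rule replaces_comp[OF v(1)])
    moreover have "length (l # w) \<le> length (if y = x then False # v else True # d # v)"
      using v(2) by simp
    ultimately show ?thesis unfolding ends(3) unfolding list.sel l fst_conv snd_conv by blast
  qed
qed simp

lemma length_le_growth:
  assumes "reduced w" "grows_by (rho w) k"
  shows "length w \<le> k"
proof (cases "w = []")
  case False
  then show ?thesis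
    using rho_prefix[OF assms(1)] assms(2) unfolding grows_by_def by fastforce
qed simp

text \<open>The identity has growth 0, so only the empty reduced word acts trivially. The induction
  moves the first letter to the other side by \<open>cons_reduce\<close>; if nothing cancelled
  there, \<open>l # u\<close> would contain \<open>l\<close> followed by its inverse.\<close>

lemma rho_inj:
  assumes "reduced u" "reduced v" "rho u = rho v"
  shows "u = v"
  using assms
proof (induction u arbitrary: v)
  case Nil
  then have "length v \<le> 0" by (metis length_le_growth grows_by_id rho_Nil)
  then show ?case by simp
next
  case (Cons l u)
  let ?l = "(fst l, \<not> snd l)"
  have "rho (cons_reduce ?l v) = letter ?l \<circ> (letter l \<circ> rho u)"
    by (simp only: rho_cons_reduce Cons.prems(3)[symmetric] rho_Cons)
  also have "\<dots> = rho u" by (simp only: o_assoc letter_comp_inverse(1) id_o)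
  finally have u: "u = cons_reduce ?l v"
    using Cons.IH[of "cons_reduce ?l v"] Cons.prems reduced_tl reduced_cons_reduce by metis
  show ?case
  proof (cases v)
    case Nil
    then show ?thesis using u Cons.prems(1) by (simp add: reduced_Cons_Cons)
  next
    case v: (Cons m w)
    show ?thesis
    proof (cases "m = l")
      case True
      then show ?thesis using u v by simp
    next
      case False
      then have "u = ?l # v" using u v by (auto simp: prod_eq_iff)
      then show ?thesis using Cons.prems(1) by (simp add: reduced_Cons_Cons)
    qed
  qed
qed

text \<open>The inverse of a word ends in the inverse of its first letter; multiplying by this
  letter through \<open>cons_reduce\<close> keeps the result reduced.\<close>

lemma rho_inverse: "\<exists>v. reduced v \<and> rho v \<circ> rho w = id"
proof (induction w)
  case Nil
  show ?case by (rule exI[of _ "[]"]) (simp add: reduced_Nil)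
next
  case (Cons l w)
  then obtain v where v: "reduced v" "rho v \<circ> rho w = id" by blast
  let ?v = "foldr cons_reduce v [(fst l, \<not> snd l)]"
  have "rho ?v \<circ> rho (l # w) = rho v \<circ> ((letter (fst l, \<not> snd l) \<circ> letter l) \<circ> rho w)"
    by (simp only: rho_mult rho_Cons rho_Nil comp_id o_assoc)
  also have "\<dots> = id" by (simp only: letter_comp_inverse(1) id_o v(2))
  finally show ?case using reduced_foldr_cons_reduce[OF reduced_single] by blast
qed

section \<open>Direct products\<close>

definition dsum :: "(bool stream \<Rightarrow> bool stream) \<Rightarrow> (bool stream \<Rightarrow> bool stream) \<Rightarrow>
    bool stream \<Rightarrow> bool stream" where
  "dsum f g z = shd z ## (if shd z then f (stl z) else g (stl z))"

lemma dsum_comp: "dsum f g \<circ> dsum f' g' = dsum (f \<circ> f') (g \<circ> g')"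
  by (auto simp: dsum_def)

lemma dsum_id: "dsum id id = id"
  by (auto simp: dsum_def)

lemma dsum_inject: "dsum f g = dsum f' g' \<longleftrightarrow> f = f' \<and> g = g'"
proof (intro iffI conjI ext)
  fix z assume eq: "dsum f g = dsum f' g'"
  show "f z = f' z" using fun_cong[OF eq, of "True ## z"] by (simp add: dsum_def)
  show "g z = g' z" using fun_cong[OF eq, of "False ## z"] by (simp add: dsum_def)
qed simp

lemma replaces_dsum:
  "replaces f u v \<Longrightarrow> replaces (dsum f g) (True # u) (True # v)"
  "replaces g u v \<Longrightarrow> replaces (dsum f g) (False # u) (False # v)"
  by (simp_all add: replaces_def dsum_def)

lemma dsum_in_cantor_V:
  assumes f: "f \<in> carrier cantor_V" and g: "g \<in> carrier cantor_V"
  shows "dsum f g \<in> carrier cantor_V"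
proof -
  have inv: "Hilbert_Choice.inv h \<circ> h = id" "h \<circ> Hilbert_Choice.inv h = id"
    if "h \<in> carrier cantor_V" for h
    using cantor_V_bij[OF that] by (auto simp: bij_def surj_iff)
  have bij: "bij (dsum f g)"
    by (rule o_bij[of "dsum (Hilbert_Choice.inv f) (Hilbert_Choice.inv g)"])
      (simp_all only: dsum_comp inv f g dsum_id)
  obtain n where n: "\<And>u. n \<le> length u \<Longrightarrow> \<exists>v. replaces f u v"
    using cantor_VE[OF f] by blast
  obtain m where m: "\<And>u. m \<le> length u \<Longrightarrow> \<exists>v. replaces g u v"
    using cantor_VE[OF g] by blast
  show ?thesis
  proof (rule cantor_VI[OF bij])
    fix u :: "bool list" assume "length u = Suc (n + m)"
    then obtain b u' where u: "u = b # u'" "length u' = n + m" by (cases u) auto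
    then obtain v w where "replaces f u' v" "replaces g u' w" using n[of u'] m[of u'] by auto
    then have "replaces (dsum f g) u (b # (if b then v else w))"
      unfolding u(1) by (cases b) (simp_all add: replaces_dsum)
    then show "\<exists>v. replaces (dsum f g) u v" ..
  qed
qed

text \<open>A common first letter in front of \<open>u\<close> and \<open>v\<close> leaves the
  difference of their lengths unchanged, so the sum grows at least as much as either
  summand.\<close>

lemma grows_by_dsum:
  assumes "grows_by (dsum f g) k"
  shows "grows_by f k" "grows_by g k"
  unfolding grows_by_def
  using assms[unfolded grows_by_def, rule_format, OF replaces_dsum(1)]
    assms[unfolded grows_by_def, rule_format, OF replaces_dsum(2)] by auto

lemma foldr_dsum:
  "foldr (\<circ>) (map (\<lambda>l. dsum (letter l) id) u) f = dsum (rho u) id \<circ> f"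
  "foldr (\<circ>) (map (\<lambda>l. dsum id (letter l)) u) f = dsum id (rho u) \<circ> f"
  by (induction u) (simp_all add: dsum_id o_assoc dsum_comp)

theorem theorem6p4:
  shows "(\<exists>H. subgroup H thompson_V \<and>
              (thompson_V\<lparr>carrier := H\<rparr>) \<cong> FG2 \<and>
              linear_distortion thompson_V H) \<and>
         (\<exists>H. subgroup H thompson_V \<and>
              (thompson_V\<lparr>carrier := H\<rparr>) \<cong> (FG2 \<times>\<times> FG2) \<and>
              linear_distortion thompson_V H)"
proof
  show "\<exists>H. subgroup H thompson_V \<and> (thompson_V\<lparr>carrier := H\<rparr>) \<cong> FG2 \<and>
      linear_distortion thompson_V H"
  proof (rule undistorted_embedding[of FG2 rho "range letter" 1])
    show "carrier FG2 \<noteq> {}" using reduced_Nil by (auto simp: carrier_FG2)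
    show "rho \<in> hom FG2 cantor_V"
      by (simp add: hom_def rho_in_cantor_V mult_FG2 rho_mult)
    show "inj_on rho (carrier FG2)" by (auto simp: inj_on_def carrier_FG2 rho_inj)
    show "range letter \<subseteq> rho ` carrier FG2"
    proof
      fix f assume "f \<in> range letter"
      then obtain l where "f = rho [l]" by auto
      then show "f \<in> rho ` carrier FG2" unfolding carrier_FG2 using reduced_single by blast
    qed
    show "\<exists>ws. set ws \<subseteq> range letter \<and> foldr (\<circ>) ws id = rho w \<and>
        (\<forall>k. grows_by (rho w) k \<longrightarrow> length ws \<le> 1 * k)" if "w \<in> carrier FG2" for w
      using that length_le_growth
      by (intro exI[of _ "map letter w"]) (auto simp: carrier_FG2 rho_def)
  qed (use rho_inverse reduced_foldr_cons_reduce in \<open>auto simp: carrier_FG2 mult_FG2\<close>)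
next
  let ?h = "\<lambda>(u, v). dsum (rho u) (rho v)"
  let ?X1 = "range (\<lambda>l. dsum (letter l) id)" and ?X2 = "range (\<lambda>l. dsum id (letter l))"
  have carrier: "carrier (FG2 \<times>\<times> FG2) = {u. reduced u} \<times> {v. reduced v}"
    by (simp add: DirProd_def carrier_FG2)
  show "\<exists>H. subgroup H thompson_V \<and> (thompson_V\<lparr>carrier := H\<rparr>) \<cong> (FG2 \<times>\<times> FG2) \<and>
      linear_distortion thompson_V H"
  proof (rule undistorted_embedding[of "FG2 \<times>\<times> FG2" ?h "?X1 \<union> ?X2" 2])
    show "carrier (FG2 \<times>\<times> FG2) \<noteq> {}" using reduced_Nil by (auto simp: carrier_FG2)
    show "p \<otimes>\<^bsub>FG2 \<times>\<times> FG2\<^esub> q \<in> carrier (FG2 \<times>\<times> FG2)"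
      if "p \<in> carrier (FG2 \<times>\<times> FG2)" "q \<in> carrier (FG2 \<times>\<times> FG2)" for p q
      using that reduced_foldr_cons_reduce by (auto simp: carrier_FG2 mult_FG2)
    show "?h \<in> hom (FG2 \<times>\<times> FG2) cantor_V"
      by (auto simp: hom_def dsum_in_cantor_V rho_in_cantor_V mult_FG2 rho_mult dsum_comp)
    show "inj_on ?h (carrier (FG2 \<times>\<times> FG2))"
      by (auto simp: inj_on_def carrier_FG2 dsum_inject rho_inj)
    show "\<exists>q\<in>carrier (FG2 \<times>\<times> FG2). ?h q \<circ> ?h p = id" if "p \<in> carrier (FG2 \<times>\<times> FG2)" for p
    proof -
      obtain u v where p: "p = (u, v)" by fastforce
      obtain u' v' where "reduced u'" "rho u' \<circ> rho u = id" "reduced v'" "rho v' \<circ> rho v = id"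
        using rho_inverse by blast
      then show ?thesis
        by (intro bexI[of _ "(u', v')"]) (simp_all add: p carrier_FG2 dsum_comp dsum_id)
    qed
    show "?X1 \<union> ?X2 \<subseteq> ?h ` carrier (FG2 \<times>\<times> FG2)"
    proof
      fix f assume "f \<in> ?X1 \<union> ?X2"
      then obtain l where "f = ?h ([l], []) \<or> f = ?h ([], [l])" by auto
      then show "f \<in> ?h ` carrier (FG2 \<times>\<times> FG2)"
        unfolding carrier
        by (elim disjE) (rule image_eqI, assumption, simp add: reduced_single reduced_Nil)+
    qed
    show "\<exists>ws. set ws \<subseteq> ?X1 \<union> ?X2 \<and> foldr (\<circ>) ws id = ?h p \<and>
        (\<forall>k. grows_by (?h p) k \<longrightarrow> length ws \<le> 2 * k)" if "p \<in> carrier (FG2 \<times>\<times> FG2)" for p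
    proof -
      obtain u v where p: "p = (u, v)" by fastforce
      have red: "reduced u" "reduced v" using that by (simp_all add: p carrier_FG2)
      \<comment> \<open>The letters of \<open>u\<close> act below \<open>[True]\<close> and those of
        \<open>v\<close> below \<open>[False]\<close>. The length is
        \<open>length u + length v\<close>, and each summand is at most the growth
        \<open>k\<close>.\<close>
      let ?ws = "map (\<lambda>l. dsum (letter l) id) u @ map (\<lambda>l. dsum id (letter l)) v"
      have "length ?ws \<le> 2 * k" if "grows_by (?h p) k" for k
        using length_le_growth[OF red(1), of k] length_le_growth[OF red(2), of k]
          grows_by_dsum[of "rho u" "rho v" k] that by (simp add: p)
      moreover have "foldr (\<circ>) ?ws id = ?h p"
        by (simp add: p foldr_dsum dsum_comp)
      ultimately show ?thesis by (intro exI[of _ ?ws]) auto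
    qed
  qed simp_all
qed

end
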